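(* Let $\mathcal{H}$ be a complex Hilbert space, let $B:\mathcal{D}(B)\to\mathcal{H}$ be a closed, densely defined operator on $\mathcal{H}$ and let $A$ be a linear operator on $\mathcal{H}$ that is relatively bounded with respect to $B$. Suppose that $0$ is an isolated point of $\sigma(B)$ at which the quasi-nilpotent part of $B$ vanishes. Let $P$ be the Riesz projection of $B$ at $0$. Then $AP\in\mathcal{B}(\mathcal{H})$, and for any $z\in\mathbb{C}$ with $|z|>\|AP\|$ and $|z|>\|PAP\|$ one has $z\notin\sigma(A+\beta B)$ for all sufficiently large $\beta>0$. Furthermore, for such $z$ there exists a constant $C\ge 0$ such that for all sufficiently large $\beta$ $$\left\|(A+\beta B-z)^{-1}-P(PAP-z)^{-1}P\right\|\le \frac{C}{\beta}\xrightarrow[\beta\to\infty]{}0 .$$ Consequently, the family $A_\beta:=A+\beta B$ converges in the generalized norm resolvent sense to the operator $\underline{A}:=PAP$.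
   Context: $A$ is relatively bounded with respect to $B$ means: $\mathcal{D}(B)\subseteq\mathcal{D}(A)$ and there are constants $a,b\ge 0$ (with $a$ not required to be less than $1$) such that $\|A\psi\|\le a\|B\psi\|+b\|\psi\|$ for all $\psi\in\mathcal{D}(B)$. The operator $A+\beta B$ has domain $\mathcal{D}(B)$. For an isolated point $0\in\sigma(B)$ the Riesz projection (in general not orthogonal) is $P=\frac{1}{2\pi i}\oint_\Gamma (w-B)^{-1}\,dw$, with $\Gamma$ a positively oriented closed contour in $\rho(B)$ encircling $0$ and no other point of $\sigma(B)$. The quasi-nilpotent part of $B$ at zero vanishes means $PB=0$ on $\mathcal{D}(B)$ (equivalently $BP=0$). Generalized norm resolvent convergence of $A_\beta$ to an operator $\underline{A}$ on $P\mathcal{H}$ means $\|(A_\beta-z)^{-1}-P(\underline{A}-z)^{-1}P\|\to 0$ as $\beta\to\infty$ (for the $z$ under consideration). *)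

theory Defs
  imports "HOL-Complex_Analysis.Complex_Analysis" "HOL-Analysis.Isolated"
begin

text \<open>Complex Hilbert spaces. The inner product is conjugate-linear in the first argument.
  The class extends \<^class>\<open>banach\<close>, so the norm, the topology and the real scalar
  multiplication are the library's; they are tied to the complex structure by the axioms
  \<open>scaleC_of_real\<close> and \<open>cinner_self\<close>.\<close>

class chilbert_space = banach +
  fixes scaleC :: "complex \<Rightarrow> 'a \<Rightarrow> 'a" (infixr \<open>*\<^sub>C\<close> 75)
    and cinner :: "'a \<Rightarrow> 'a \<Rightarrow> complex"
  assumes scaleC_add_right: "c *\<^sub>C (x + y) = c *\<^sub>C x + c *\<^sub>C y"
    and scaleC_add_left: "(c + d) *\<^sub>C x = c *\<^sub>C x + d *\<^sub>C x"
    and scaleC_scaleC: "c *\<^sub>C (d *\<^sub>C x) = (c * d) *\<^sub>C x"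
    and scaleC_of_real: "complex_of_real r *\<^sub>C x = r *\<^sub>R x"
    and cinner_commute: "cinner x y = cnj (cinner y x)"
    and cinner_add_right: "cinner x (y + z) = cinner x y + cinner x z"
    and cinner_scaleC_right: "cinner x (c *\<^sub>C y) = c * cinner x y"
    and cinner_self: "cinner x x = complex_of_real ((norm x)\<^sup>2)"

instantiation complex :: chilbert_space
begin

definition "c *\<^sub>C (x :: complex) = c * x"

definition "cinner (x :: complex) y = cnj x * y"

instance
  by standard
    (auto simp: scaleC_complex_def cinner_complex_def algebra_simps scaleR_conv_of_real
       simp flip: complex_norm_square)

end

definition bounded_clinear :: "('a::chilbert_space \<Rightarrow> 'a) \<Rightarrow> bool" where
  "bounded_clinear f \<longleftrightarrow> bounded_linear f \<and> (\<forall>c x. f (c *\<^sub>C x) = c *\<^sub>C f x)"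


text \<open>Unbounded operators. The values of \<open>app T\<close> outside \<open>domain T\<close> carry no meaning and are
  never used.\<close>

record 'a unbounded_operator =
  domain :: "'a set"
  app :: "'a \<Rightarrow> 'a"

definition linear_operator :: "('a::chilbert_space) unbounded_operator \<Rightarrow> bool" where
  "linear_operator T \<longleftrightarrow>
     0 \<in> domain T \<and>
     (\<forall>x\<in>domain T. \<forall>y\<in>domain T. x + y \<in> domain T \<and> app T (x + y) = app T x + app T y) \<and>
     (\<forall>c. \<forall>x\<in>domain T. c *\<^sub>C x \<in> domain T \<and> app T (c *\<^sub>C x) = c *\<^sub>C app T x)"

definition closed_operator :: "('a::chilbert_space) unbounded_operator \<Rightarrow> bool" where
  "closed_operator T \<longleftrightarrow> closed {(x, app T x) | x. x \<in> domain T}"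

definition densely_defined :: "('a::chilbert_space) unbounded_operator \<Rightarrow> bool" where
  "densely_defined T \<longleftrightarrow> closure (domain T) = UNIV"

definition relatively_bounded ::
    "('a::chilbert_space) unbounded_operator \<Rightarrow> 'a unbounded_operator \<Rightarrow> bool" where
  "relatively_bounded A B \<longleftrightarrow>
     domain B \<subseteq> domain A \<and>
     (\<exists>a\<ge>0. \<exists>b\<ge>0. \<forall>x\<in>domain B. norm (app A x) \<le> a * norm (app B x) + b * norm x)"

text \<open>The operator \<open>A + \<beta> B\<close>, with domain that of \<open>B\<close>.\<close>

definition op_pencil ::
    "('a::chilbert_space) unbounded_operator \<Rightarrow> 'a unbounded_operator \<Rightarrow> real \<Rightarrow> 'a unbounded_operator" where
  "op_pencil A B \<beta> =
     \<lparr>domain = domain B, app = (\<lambda>x. app A x + complex_of_real \<beta> *\<^sub>C app B x)\<rparr>"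


text \<open>\<open>resolvent T z\<close> is \<open>(T - z)\<^sup>-\<^sup>1\<close>, to be read only where \<open>T - z\<close> is injective and on the
  range of \<open>T - z\<close>. The subspace \<open>K\<close> in \<open>resolvent_set_on K T\<close> is the space in which \<open>T\<close> acts:
  the whole space (\<^term>\<open>UNIV\<close>), or the range of a projection for an operator on that range.\<close>

definition resolvent :: "('a::chilbert_space) unbounded_operator \<Rightarrow> complex \<Rightarrow> 'a \<Rightarrow> 'a" where
  "resolvent T z = inv_into (domain T) (\<lambda>x. app T x - z *\<^sub>C x)"

definition resolvent_set_on :: "'a set \<Rightarrow> ('a::chilbert_space) unbounded_operator \<Rightarrow> complex set" where
  "resolvent_set_on K T =
     {z. bij_betw (\<lambda>x. app T x - z *\<^sub>C x) (domain T) K \<and>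
         (\<exists>M. \<forall>y\<in>K. norm (resolvent T z y) \<le> M * norm y)}"

abbreviation resolvent_set :: "('a::chilbert_space) unbounded_operator \<Rightarrow> complex set" where
  "resolvent_set T \<equiv> resolvent_set_on UNIV T"

definition spectrum :: "('a::chilbert_space) unbounded_operator \<Rightarrow> complex set" where
  "spectrum T = - resolvent_set T"


text \<open>A closed contour in the resolvent set winding once, positively, around \<open>z0\<close> and not around
  any other point of the spectrum.\<close>

definition encircling_contour ::
    "('a::chilbert_space) unbounded_operator \<Rightarrow> complex \<Rightarrow> (real \<Rightarrow> complex) \<Rightarrow> bool" where
  "encircling_contour T z0 \<gamma> \<longleftrightarrow>
     valid_path \<gamma> \<and> pathfinish \<gamma> = pathstart \<gamma> \<and> path_image \<gamma> \<subseteq> resolvent_set T \<and>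
     winding_number \<gamma> z0 = 1 \<and> (\<forall>w\<in>spectrum T - {z0}. winding_number \<gamma> w = 0)"

text \<open>\<open>1 / (2 \<pi> i)\<close> times the contour integral of \<open>(w - T)\<^sup>-\<^sup>1 = - (T - w)\<^sup>-\<^sup>1\<close> along \<open>\<gamma>\<close>, an integral
  with respect to the operator norm. The library's contour integral is only for complex-valued
  integrands, so its definition is repeated for operator values. The type of the integrand only
  provides real-linear operators, whence the factor \<open>\<gamma>'(t)\<close> is multiplied pointwise.\<close>

definition riesz_projection ::
    "('a::chilbert_space) unbounded_operator \<Rightarrow> (real \<Rightarrow> complex) \<Rightarrow> 'a \<Rightarrow> 'a" where
  "riesz_projection T \<gamma> x =
     (1 / (2 * complex_of_real pi * \<i>)) *\<^sub>C
     blinfun_apply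
       (integral {0..1}
          (\<lambda>t. Blinfun (\<lambda>y. vector_derivative \<gamma> (at t within {0..1}) *\<^sub>C (- resolvent T (\<gamma> t) y))))
       x"

definition quasinilpotent_part_vanishes ::
    "('a::chilbert_space) unbounded_operator \<Rightarrow> ('a \<Rightarrow> 'a) \<Rightarrow> bool" where
  "quasinilpotent_part_vanishes B P \<longleftrightarrow> (\<forall>x\<in>domain B. P (app B x) = 0)"


text \<open>Generalized norm resolvent convergence, at the point \<open>z\<close> and as \<open>\<beta> \<rightarrow> \<infinity>\<close>, of operators \<open>T \<beta>\<close>
  on the whole space to an operator \<open>S\<close> on the range of \<open>P\<close>. The inverse in \<open>P (S - z)\<^sup>-\<^sup>1 P\<close> is
  thus taken in the range of \<open>P\<close>. The first two conditions make the inverses meaningful.\<close>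

definition gen_norm_resolvent_conv ::
    "(real \<Rightarrow> ('a::chilbert_space) unbounded_operator) \<Rightarrow> ('a \<Rightarrow> 'a) \<Rightarrow> 'a unbounded_operator \<Rightarrow> complex \<Rightarrow> bool" where
  "gen_norm_resolvent_conv T P S z \<longleftrightarrow>
     z \<in> resolvent_set_on (range P) S \<and>
     (\<forall>\<^sub>F \<beta> in at_top. z \<in> resolvent_set (T \<beta>)) \<and>
     ((\<lambda>\<beta>. onorm (\<lambda>x. resolvent (T \<beta>) z x - P (resolvent S z (P x)))) \<longlongrightarrow> 0) at_top"

end

theory Submission
  imports Defs
begin

text \<open>Two integrals over the contour \<open>\<gamma>\<close> carry the proof: the Riesz projection \<open>P\<close>, which up to sign is the
  normalised integral of the resolvent \<open>R w = (B - w)\<^sup>-\<^sup>1\<close>, and \<open>S = (1 / 2\<pi>i) \<integral> R w / w dw\<close>. From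
  \<open>B (R w) = 1 + w R w\<close> and \<open>\<integral> dw / w = 2\<pi>i\<close>, the winding number about \<open>0\<close> being \<open>1\<close>, one reads off
  \<open>B S = 1 - P\<close>, and \<open>S B = 1 - P\<close> on the domain of \<open>B\<close> (lemma \<open>reduced_resolvent\<close>). If moreover
  \<open>P B = 0\<close>, then \<open>B P = 0\<close> on the domain, by density and closedness \<open>B P = 0\<close> everywhere, and
  \<open>P P = P - S B P = P\<close>. So \<open>P\<close> is a bounded projection onto the kernel of \<open>B\<close>, and after replacing
  \<open>S\<close> by \<open>(1 - P) S (1 - P)\<close>, \<open>B\<close> has the bounded inverse \<open>S\<close> on the range of \<open>1 - P\<close>
  (lemma \<open>pencil_decouples\<close>). As \<open>A\<close> is relatively bounded, \<open>A P\<close> and \<open>A S\<close> are bounded.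
  
  Now split the space by \<open>P\<close>. In block form \<open>A + \<beta> B - z\<close> is \<open>PAP - z\<close> in the upper left corner, has
  the \<open>\<beta>\<close>-independent entry \<open>(1 - P) A P\<close> below it, and \<open>\<beta> B\<close> plus a part that \<open>S\<close> makes bounded in the
  right column. With \<open>\<beta> B\<close> dominant, its inverse should be close to that of the lower triangular
  matrix with diagonal \<open>PAP - z\<close> and \<open>\<beta> B\<close>. Precisely, put \<open>X = P (PAP - z)\<^sup>-\<^sup>1 P\<close> and
  \<open>N = (1 - P) A X\<close>, so that \<open>N N = 0\<close> and \<open>1 + N\<close> has the inverse \<open>1 - N\<close>. Then
  \<open>G = X + (1/\<beta>) S (1 - N)\<close> maps onto the domain of \<open>B\<close> and
  \<open>(A + \<beta> B - z) G = 1 + (1/\<beta>) L\<close> with \<open>L\<close> bounded and independent of \<open>\<beta>\<close> (lemmas \<open>G_surj\<close> and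
  \<open>pencil_G\<close>). For large \<open>\<beta>\<close> a Neumann argument inverts \<open>1 + (1/\<beta>) L\<close>, whence \<open>z\<close> is in the resolvent
  set and the resolvent is \<open>G (1 + (1/\<beta>) L)\<^sup>-\<^sup>1 = X + O(1/\<beta>)\<close> (lemma \<open>pencil_resolvent\<close>).
  
  The analytic point is that the two integrals exist in the operator norm. The derivative of a
  piecewise continuously differentiable path may be unbounded, even not absolutely integrable, near
  its exceptional points, so continuity of the resolvent along the path is not enough. What makes
  the Henstock-Kurzweil integral exist is that the resolvent is holomorphic in operator norm and
  therefore has local primitives; the fundamental theorem of calculus tolerates finitely many
  exceptional points (lemmas \<open>local_primitive\<close> and \<open>path_integrable\<close>).\<close>

section \<open>Complex scaling\<close>

text \<open>Only the norm of \<open>x\<close> itself is tied to the inner product by the axioms; the identity is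
  \<open>\<langle>cx, cx\<rangle> = |c|\<^sup>2 \<langle>x, x\<rangle>\<close> read through that axiom.\<close>

lemma norm_scaleC: "norm (c *\<^sub>C (x::'a::chilbert_space)) = cmod c * norm x"
proof -
  have "complex_of_real ((norm (c *\<^sub>C x))\<^sup>2) = c * cinner (c *\<^sub>C x) x"
    by (metis cinner_self cinner_scaleC_right)
  also have "\<dots> = c * cnj (c * cinner x x)"
    by (metis cinner_commute cinner_scaleC_right)
  also have "\<dots> = complex_of_real ((cmod c * norm x)\<^sup>2)"
    by (simp add: cinner_self power_mult_distrib mult.assoc mult.left_commute flip: complex_norm_square)
  finally have "(norm (c *\<^sub>C x))\<^sup>2 = (cmod c * norm x)\<^sup>2"
    using of_real_eq_iff by blast
  then show ?thesis
    by (simp add: power2_eq_iff_nonneg)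
qed

lemma scaleC_1 [simp]: "1 *\<^sub>C (x::'a::chilbert_space) = x"
  using scaleC_of_real [of 1 x] by simp

lemma bounded_bilinear_scaleC: "bounded_bilinear ((*\<^sub>C) :: complex \<Rightarrow> 'a::chilbert_space \<Rightarrow> 'a)"
proof
  fix a a' :: complex and b b' :: 'a and r :: real
  show "(a + a') *\<^sub>C b = a *\<^sub>C b + a' *\<^sub>C b" "a *\<^sub>C (b + b') = a *\<^sub>C b + a *\<^sub>C b'"
    by (simp_all add: scaleC_add_left scaleC_add_right)
  show "(r *\<^sub>R a) *\<^sub>C b = r *\<^sub>R (a *\<^sub>C b)" "a *\<^sub>C (r *\<^sub>R b) = r *\<^sub>R (a *\<^sub>C b)"
    by (simp_all add: scaleC_scaleC scaleR_conv_of_real mult.commute flip: scaleC_of_real)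
  show "\<exists>K. \<forall>a (b::'a). norm (a *\<^sub>C b) \<le> norm a * norm b * K"
    by (rule exI [of _ 1]) (simp add: norm_scaleC)
qed

interpretation scaleC: bounded_bilinear "(*\<^sub>C) :: complex \<Rightarrow> 'a::chilbert_space \<Rightarrow> 'a"
  by (rule bounded_bilinear_scaleC)

section \<open>Contour integrals of Banach-valued holomorphic functions\<close>

text \<open>The type of bounded operators carries only a real vector space structure. This locale abstracts
  a compatible multiplication by complex scalars; holomorphy of \<open>f\<close> with derivative \<open>f'\<close> is then
  expressed by the Frechet derivative \<open>\<lambda>h. m h (f' w)\<close>.\<close>

locale complex_scaling = bounded_bilinear m
  for m :: "complex \<Rightarrow> 'b::banach \<Rightarrow> 'b" +
  assumes m_mult: "m (c * d) x = m c (m d x)" and m_one: "m 1 x = x"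
begin

lemma m_commute: "m c (m d x) = m d (m c x)"
  by (metis m_mult mult.commute)

text \<open>The primitive is the integral along the segment from the centre,
  \<open>F w = (w - w0) \<integral>\<^sub>0\<^sup>1 f (w0 + t (w - w0)) dt\<close>. Differentiating under the integral sign turns the
  claim into \<open>\<integral>\<^sub>0\<^sup>1 (d/dt) (t f (w0 + t (w - w0))) dt = f w\<close>, which avoids Cauchy's theorem.\<close>

lemma local_primitive:
  assumes der: "\<And>w. w \<in> ball w0 r \<Longrightarrow> (f has_derivative (\<lambda>h. m h (f' w))) (at w)"
    and cont: "continuous_on (ball w0 r) f'"
  obtains F where "\<And>w. w \<in> ball w0 r \<Longrightarrow> (F has_derivative (\<lambda>h. m h (f w))) (at w)"
proof -
  define I where "I w = integral (cbox 0 1) (\<lambda>t::real. f (w0 + t *\<^sub>R (w - w0)))" for w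
  define D where "D w t = prod_left (t *\<^sub>R f' (w0 + t *\<^sub>R (w - w0)))" for w and t :: real
  have seg: "w0 + t *\<^sub>R (w - w0) \<in> ball w0 r" if "w \<in> ball w0 r" "t \<in> cbox 0 1" for w t
  proof -
    have "norm (t *\<^sub>R (w - w0)) \<le> 1 * norm (w - w0)"
      unfolding norm_scaleR using that by (intro mult_right_mono) auto
    then show ?thesis
      using that(1) by (simp add: dist_norm norm_minus_commute)
  qed
  have contf: "continuous_on (ball w0 r) f"
    using der by (meson continuous_at_imp_continuous_on has_derivative_continuous)
  have contD: "continuous_on (ball w0 r \<times> cbox 0 1) (\<lambda>(w, t). D w t)"
    unfolding D_def split_beta
    by (intro bounded_linear.continuous_on [OF bounded_linear_prod_left] continuous_intros
        continuous_on_compose2 [OF cont]) (use seg in force)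
  have I_der: "(I has_derivative blinfun_apply (integral (cbox 0 1) (D w))) (at w)"
    if "w \<in> ball w0 r" for w
  proof -
    have "(I has_derivative blinfun_apply (integral (cbox 0 1) (D w))) (at w within ball w0 r)"
      unfolding I_def
    proof (rule leibniz_rule)
      fix v :: complex and t :: real
      assume v: "v \<in> ball w0 r" "t \<in> cbox 0 1"
      have "((\<lambda>x. f (w0 + t *\<^sub>R (x - w0))) has_derivative
          (\<lambda>h. m (t *\<^sub>R h) (f' (w0 + t *\<^sub>R (v - w0))))) (at v within ball w0 r)"
        by (rule has_derivative_compose [where g = f and f = "\<lambda>x. w0 + t *\<^sub>R (x - w0)", OF _ der [OF seg [OF v]]])
          (auto intro!: derivative_eq_intros)
      then show "((\<lambda>x. f (w0 + t *\<^sub>R (x - w0))) has_derivative blinfun_apply (D v t))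
          (at v within ball w0 r)"
        by (simp add: D_def scaleR_left scaleR_right)
    next
      fix v assume v: "v \<in> ball w0 r"
      show "(\<lambda>t. f (w0 + t *\<^sub>R (v - w0))) integrable_on cbox 0 (1::real)"
        by (intro integrable_continuous continuous_on_compose2 [OF contf] continuous_intros)
          (use seg v in force)
    qed (use contD that in auto)
    then show ?thesis
      by (simp only: at_within_open [OF that open_ball])
  qed
  have "((\<lambda>w. m (w - w0) (I w)) has_derivative (\<lambda>h. m h (f w))) (at w)"
    if w: "w \<in> ball w0 r" for w
  proof -
    let ?p = "\<lambda>t::real. w0 + t *\<^sub>R (w - w0)"
    have contD1: "continuous_on (cbox 0 1) (D w)"
      using continuous_on_compose2 [OF contD, of "cbox 0 1" "\<lambda>t. (w, t)"] w
      by (force intro: continuous_intros)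
    have cf: "continuous_on (cbox 0 1) (\<lambda>t. f (?p t))"
      by (intro continuous_on_compose2 [OF contf] continuous_intros) (use seg w in force)
    have cf': "continuous_on (cbox 0 1) (\<lambda>t. t *\<^sub>R f' (?p t))"
      by (intro continuous_on_compose2 [OF cont] continuous_intros) (use seg w in force)
    define J where "J = integral (cbox 0 1) (\<lambda>t. t *\<^sub>R f' (?p t))"
    have J: "blinfun_apply (integral (cbox 0 1) (D w)) h = m h J" for h
    proof -
      have "blinfun_apply (integral (cbox 0 1) (D w)) h = integral (cbox 0 1) (\<lambda>t. D w t h)"
        using integral_linear [OF integrable_continuous [OF contD1], of "\<lambda>T. blinfun_apply T h"]
        by (simp add: o_def blinfun.bounded_linear_left)
      also have "\<dots> = m h J"
        using integral_linear [OF integrable_continuous [OF cf'], of "m h"]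
        by (simp add: o_def bounded_linear_right D_def J_def)
      finally show ?thesis .
    qed
    have "((\<lambda>t. f (?p t) + m (w - w0) (t *\<^sub>R f' (?p t))) has_integral
        (1 *\<^sub>R f (?p 1) - 0 *\<^sub>R f (?p 0))) {0..1}"
    proof (rule fundamental_theorem_of_calculus)
      fix t :: real assume t: "t \<in> {0..1}"
      have "((\<lambda>t. f (?p t)) has_derivative (\<lambda>h. m (h *\<^sub>R (w - w0)) (f' (?p t)))) (at t within {0..1})"
        by (rule has_derivative_compose [where g = f and f = ?p, OF _ der [OF seg [OF w]]])
          (use t in \<open>auto intro!: derivative_eq_intros\<close>)
      then have "((\<lambda>t. f (?p t)) has_vector_derivative m (w - w0) (f' (?p t))) (at t within {0..1})"
        by (simp add: has_vector_derivative_def scaleR_left)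
      then have "((\<lambda>t. t *\<^sub>R f (?p t)) has_vector_derivative
          (t *\<^sub>R m (w - w0) (f' (?p t)) + 1 *\<^sub>R f (?p t))) (at t within {0..1})"
        by (intro has_vector_derivative_scaleR) (auto intro!: derivative_eq_intros)
      then show "((\<lambda>t. t *\<^sub>R f (?p t)) has_vector_derivative
          f (?p t) + m (w - w0) (t *\<^sub>R f' (?p t))) (at t within {0..1})"
        by (simp add: scaleR_right add.commute)
    qed simp
    moreover have "((\<lambda>t. f (?p t) + m (w - w0) (t *\<^sub>R f' (?p t))) has_integral
        (I w + m (w - w0) J)) (cbox 0 1)"
      unfolding I_def J_def
      using has_integral_linear [OF integrable_integral [OF integrable_continuous [OF cf']]
          bounded_linear_right [of "w - w0"]]
      by (intro has_integral_add integrable_integral integrable_continuous cf) (simp add: o_def)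
    ultimately have "I w + m (w - w0) J = 1 *\<^sub>R f (?p 1) - 0 *\<^sub>R f (?p 0)"
      unfolding box_real by (rule has_integral_unique [rotated])
    then have eq: "I w + m (w - w0) J = f w"
      by simp
    have "((\<lambda>w. m (w - w0) (I w)) has_derivative
        (\<lambda>h. m (w - w0) (blinfun_apply (integral (cbox 0 1) (D w)) h) + m h (I w))) (at w)"
      by (rule FDERIV [OF _ I_der [OF w]]) (auto intro!: derivative_eq_intros)
    moreover have "m (w - w0) (m h J) + m h (I w) = m h (f w)" for h
      using eq m_commute [of "w - w0" h J] by (metis add.commute add_right)
    ultimately show ?thesis
      by (simp only: J)
  qed
  then show thesis
    using that by blast
qed

text \<open>On a short piece of the path the integrand is, off finitely many points, the derivative of the
  continuous function \<open>F \<circ> \<gamma>\<close> with \<open>F\<close> a local primitive; hence it is integrable there although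
  \<open>\<gamma>'\<close> may be unbounded. Compactness of \<open>[0, 1]\<close> glues the pieces.\<close>

lemma path_integrable:
  assumes \<gamma>: "valid_path \<gamma>" "path_image \<gamma> \<subseteq> U" and U: "open U"
    and der: "\<And>w. w \<in> U \<Longrightarrow> (f has_derivative (\<lambda>h. m h (f' w))) (at w)"
    and cont: "continuous_on U f'"
  shows "(\<lambda>t. m (vector_derivative \<gamma> (at t within {0..1})) (f (\<gamma> t))) integrable_on {0..1}"
proof -
  let ?g = "\<lambda>t. m (vector_derivative \<gamma> (at t within {0..1})) (f (\<gamma> t))"
  obtain S D where S: "finite S" and D: "\<And>t. t \<in> {0..1} - S \<Longrightarrow> (\<gamma> has_vector_derivative D t) (at t)"
    and cont\<gamma>: "continuous_on {0..1} \<gamma>"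
    using \<gamma>(1) unfolding valid_path_def piecewise_C1_differentiable_on_def C1_differentiable_on_def
    by blast
  have "\<exists>d>0. \<forall>u v. x \<in> cbox u v \<and> cbox u v \<subseteq> ball x d \<and> cbox u v \<subseteq> cbox 0 1 \<longrightarrow>
      ?g integrable_on cbox u v" if x: "x \<in> cbox 0 1" for x
  proof -
    have "\<gamma> x \<in> U"
      using x \<gamma>(2) by (auto simp: path_image_def)
    then obtain r where r: "r > 0" "ball (\<gamma> x) r \<subseteq> U"
      using U by (meson openE)
    obtain F where F: "\<And>w. w \<in> ball (\<gamma> x) r \<Longrightarrow> (F has_derivative (\<lambda>h. m h (f w))) (at w)"
      using local_primitive [of "\<gamma> x" r f f'] der continuous_on_subset [OF cont r(2)] r(2) by blast
    obtain d where d: "d > 0" "\<And>t. t \<in> {0..1} \<Longrightarrow> dist t x < d \<Longrightarrow> \<gamma> t \<in> ball (\<gamma> x) r"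
      using cont\<gamma> x r(1) unfolding continuous_on_iff by (metis box_real(2) dist_commute mem_ball)
    have "?g integrable_on cbox u v"
      if uv: "x \<in> cbox u v" "cbox u v \<subseteq> ball x d" "cbox u v \<subseteq> cbox 0 1" for u v
    proof -
      have in_ball: "\<gamma> t \<in> ball (\<gamma> x) r" if "t \<in> {u..v}" for t
        using d(2) [of t] that uv by (auto simp: dist_commute subset_iff)
      have contF: "continuous_on (ball (\<gamma> x) r) F"
        using F by (meson continuous_at_imp_continuous_on has_derivative_continuous)
      have "(?g has_integral (F (\<gamma> v) - F (\<gamma> u))) {u..v}"
      proof (rule fundamental_theorem_of_calculus_strong [OF S, where f = "\<lambda>t. F (\<gamma> t)"])
        fix t assume t: "t \<in> {u..v} - S"
        then have t01: "t \<in> {0..1}" using uv(3) by auto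
        have vd: "vector_derivative \<gamma> (at t within {0..1}) = D t"
          using D [of t] t t01 by (intro vector_derivative_at_within_ivl) auto
        have "((\<lambda>t. F (\<gamma> t)) has_derivative (\<lambda>h. m (h *\<^sub>R D t) (f (\<gamma> t)))) (at t)"
          by (rule has_derivative_compose [where g = F and f = \<gamma>, OF _ F [OF in_ball]])
            (use D t t01 in \<open>auto simp: has_vector_derivative_def\<close>)
        then show "((\<lambda>t. F (\<gamma> t)) has_vector_derivative ?g t) (at t)"
          by (simp add: has_vector_derivative_def scaleR_left vd)
      next
        show "continuous_on {u..v} (\<lambda>t. F (\<gamma> t))"
          using in_ball uv(3)
          by (intro continuous_on_compose2 [OF contF] continuous_on_subset [OF cont\<gamma>]) auto
      qed (use uv(1) in auto)
      then show ?thesis by auto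
    qed
    then show ?thesis using d(1) by blast
  qed
  then show ?thesis
    using integrable_on_little_subintervals [of 0 1 ?g] by simp
qed

lemma has_derivative_scaled:
  assumes "(f has_derivative (\<lambda>h. m h f')) (at w)" and "(g has_field_derivative g') (at w)"
  shows "((\<lambda>w. m (g w) (f w)) has_derivative (\<lambda>h. m h (m (g w) f' + m g' (f w)))) (at w)"
proof -
  have "((\<lambda>w. m (g w) (f w)) has_derivative (\<lambda>h. m (g w) (m h f') + m (g' * h) (f w))) (at w)"
    using assms(2) by (intro FDERIV assms(1)) (simp add: has_field_derivative_def)
  moreover have "m (g w) (m h f') + m (g' * h) (f w) = m h (m (g w) f' + m g' (f w))" for h
    by (metis add_right m_commute m_mult)
  ultimately show ?thesis
    by simp
qed

end

section \<open>Resolvents of unbounded operators\<close>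

lemma identity_minus_contraction_invertible:
  fixes T :: "'a::banach \<Rightarrow> 'a"
  assumes T: "bounded_linear T" and bound: "\<And>x. norm (T x) \<le> q * norm x" and q: "0 \<le> q" "q < 1"
  shows "\<exists>x. x - T x = y" and "norm x \<le> norm (x - T x) / (1 - q)"
proof -
  interpret T: bounded_linear T by (rule T)
  have "\<exists>!x. y + T x = x"
    using q bound by (intro banach_fix_type [of q]) (auto simp: dist_norm simp flip: T.diff)
  then show "\<exists>x. x - T x = y"
    by (metis add_diff_cancel_right')
  have "norm x - q * norm x \<le> norm (x - T x)"
    using norm_triangle_ineq2 [of x "T x"] bound [of x] by linarith
  then show "norm x \<le> norm (x - T x) / (1 - q)"
    using q by (simp add: field_simps)
qed

lemma linear_operator_simps:
  assumes "linear_operator T"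
  shows "x \<in> domain T \<Longrightarrow> y \<in> domain T \<Longrightarrow> x + y \<in> domain T"
    and "x \<in> domain T \<Longrightarrow> y \<in> domain T \<Longrightarrow> app T (x + y) = app T x + app T y"
    and "x \<in> domain T \<Longrightarrow> c *\<^sub>C x \<in> domain T"
    and "x \<in> domain T \<Longrightarrow> app T (c *\<^sub>C x) = c *\<^sub>C app T x"
    and "x \<in> domain T \<Longrightarrow> y \<in> domain T \<Longrightarrow> x - y \<in> domain T"
    and "x \<in> domain T \<Longrightarrow> y \<in> domain T \<Longrightarrow> app T (x - y) = app T x - app T y"
    and "0 \<in> domain T"
proof -
  show "0 \<in> domain T"
    using assms by (simp add: linear_operator_def)
  show add: "x \<in> domain T \<Longrightarrow> y \<in> domain T \<Longrightarrow> x + y \<in> domain T"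
      "x \<in> domain T \<Longrightarrow> y \<in> domain T \<Longrightarrow> app T (x + y) = app T x + app T y"
    and sc: "x \<in> domain T \<Longrightarrow> c *\<^sub>C x \<in> domain T"
      "x \<in> domain T \<Longrightarrow> app T (c *\<^sub>C x) = c *\<^sub>C app T x" for x y c
    using assms by (auto simp: linear_operator_def)
  have neg: "- x = (-1) *\<^sub>C x" for x :: 'a
    using scaleC.minus_left [of 1 x] by simp
  show "x - y \<in> domain T" if "x \<in> domain T" "y \<in> domain T"
    using add(1) [OF that(1) sc(1) [OF that(2), of "-1"]] by (simp flip: neg)
  show "app T (x - y) = app T x - app T y" if "x \<in> domain T" "y \<in> domain T"
    using add(2) [OF that(1) sc(1) [OF that(2), of "-1"]] sc(2) [OF that(2), of "-1"]
    by (simp flip: neg)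
qed

lemma resolvent_eqI:
  assumes "z \<in> resolvent_set_on K T" "x \<in> domain T" "app T x - z *\<^sub>C x = y"
  shows "resolvent T z y = x"
  using assms unfolding resolvent_set_on_def resolvent_def
  by (auto intro!: inv_into_f_eq dest: bij_betw_imp_inj_on)

lemma resolvent_solves:
  assumes "z \<in> resolvent_set_on K T" "y \<in> K"
  shows "resolvent T z y \<in> domain T"
    and "app T (resolvent T z y) - z *\<^sub>C resolvent T z y = y"
proof -
  have "y \<in> (\<lambda>x. app T x - z *\<^sub>C x) ` domain T"
    using assms by (auto simp: resolvent_set_on_def dest: bij_betw_imp_surj_on)
  then show "resolvent T z y \<in> domain T"
    and "app T (resolvent T z y) - z *\<^sub>C resolvent T z y = y"
    unfolding resolvent_def by (simp_all add: inv_into_into f_inv_into_f [where f = "\<lambda>x. app T x - z *\<^sub>C x"])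
qed

text \<open>The lower bound contains injectivity, so surjectivity and this estimate are all that has to be
  verified for each operator below.\<close>

lemma resolvent_set_onI:
  assumes T: "linear_operator T"
    and K: "\<And>x. x \<in> domain T \<Longrightarrow> app T x - z *\<^sub>C x \<in> K"
    and surj: "\<And>y. y \<in> K \<Longrightarrow> \<exists>x\<in>domain T. app T x - z *\<^sub>C x = y"
    and bound: "\<And>x. x \<in> domain T \<Longrightarrow> norm x \<le> M * norm (app T x - z *\<^sub>C x)"
  shows "z \<in> resolvent_set_on K T"
proof -
  let ?f = "\<lambda>x. app T x - z *\<^sub>C x"
  have inj: "inj_on ?f (domain T)"
  proof (rule inj_onI)
    fix x y assume xy: "x \<in> domain T" "y \<in> domain T" "?f x = ?f y"
    then have "app T (x - y) - z *\<^sub>C (x - y) = 0"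
      by (simp add: linear_operator_simps [OF T] scaleC.diff_right algebra_simps)
    then show "x = y"
      using bound [of "x - y"] xy linear_operator_simps(5) [OF T] by fastforce
  qed
  have bij: "bij_betw ?f (domain T) K"
    using inj K surj unfolding bij_betw_def by fastforce
  have "norm (resolvent T z y) \<le> M * norm y" if "y \<in> K" for y
  proof -
    obtain x where x: "x \<in> domain T" "?f x = y"
      using surj \<open>y \<in> K\<close> by blast
    then have "resolvent T z y = x"
      unfolding resolvent_def by (auto intro: inv_into_f_eq inj)
    then show ?thesis
      using bound [OF x(1)] x(2) by simp
  qed
  then show ?thesis
    using bij by (auto simp: resolvent_set_on_def)
qed

lemma resolvent_bound:
  assumes "w \<in> resolvent_set T"
  obtains M where "M > 0" "\<And>y. norm (resolvent T w y) \<le> M * norm y"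
proof -
  obtain M where M: "\<And>y. norm (resolvent T w y) \<le> M * norm y"
    using assms by (auto simp: resolvent_set_on_def)
  have "norm (resolvent T w y) \<le> max M 1 * norm y" for y
    using M [of y] by (meson dual_order.trans max.cobounded1 mult_right_mono norm_ge_zero)
  then show thesis
    using that [of "max M 1"] by simp
qed

lemma bounded_clinear_resolvent:
  assumes T: "linear_operator T" and w: "w \<in> resolvent_set T"
  shows "bounded_clinear (resolvent T w)"
proof -
  note sol = resolvent_solves [OF w UNIV_I]
  have add: "resolvent T w (x + y) = resolvent T w x + resolvent T w y" for x y
  proof (rule resolvent_eqI [OF w])
    show "resolvent T w x + resolvent T w y \<in> domain T"
      by (intro linear_operator_simps(1) [OF T] sol)
    have "app T (resolvent T w x + resolvent T w y) - w *\<^sub>C (resolvent T w x + resolvent T w y)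
        = (app T (resolvent T w x) - w *\<^sub>C resolvent T w x)
          + (app T (resolvent T w y) - w *\<^sub>C resolvent T w y)"
      by (simp add: linear_operator_simps(2) [OF T] sol(1) scaleC_add_right)
    then show "app T (resolvent T w x + resolvent T w y) - w *\<^sub>C (resolvent T w x + resolvent T w y) = x + y"
      by (simp only: sol(2))
  qed
  have sc: "resolvent T w (c *\<^sub>C x) = c *\<^sub>C resolvent T w x" for c x
  proof (rule resolvent_eqI [OF w])
    show "c *\<^sub>C resolvent T w x \<in> domain T"
      by (intro linear_operator_simps(3) [OF T] sol)
    have "app T (c *\<^sub>C resolvent T w x) - w *\<^sub>C (c *\<^sub>C resolvent T w x)
        = c *\<^sub>C (app T (resolvent T w x) - w *\<^sub>C resolvent T w x)"
      by (simp add: linear_operator_simps(4) [OF T] sol(1) scaleC.diff_right scaleC_scaleC mult.commute)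
    then show "app T (c *\<^sub>C resolvent T w x) - w *\<^sub>C (c *\<^sub>C resolvent T w x) = c *\<^sub>C x"
      by (simp only: sol(2))
  qed
  obtain M where M: "\<And>y. norm (resolvent T w y) \<le> M * norm y"
    using resolvent_bound [OF w] by blast
  have "bounded_linear (resolvent T w)"
  proof (rule bounded_linear_intro [where K = M])
    show "resolvent T w (r *\<^sub>R x) = r *\<^sub>R resolvent T w x" for r x
      using sc [of "complex_of_real r"] by (simp add: scaleC_of_real)
  qed (use add M in \<open>auto simp: mult.commute\<close>)
  with sc show ?thesis
    by (simp add: bounded_clinear_def)
qed

text \<open>Since \<open>(T - v) (R w y) = y - (v - w) R w y\<close>, it suffices to apply \<open>R v\<close> to both sides.\<close>

lemma resolvent_identity:
  assumes T: "linear_operator T" and w: "w \<in> resolvent_set T" and v: "v \<in> resolvent_set T"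
  shows "resolvent T v y - resolvent T w y = (v - w) *\<^sub>C resolvent T v (resolvent T w y)"
proof -
  interpret R: bounded_linear "resolvent T v"
    using bounded_clinear_resolvent [OF T v] by (simp add: bounded_clinear_def)
  let ?x = "resolvent T w y"
  have "app T ?x - v *\<^sub>C ?x = (app T ?x - w *\<^sub>C ?x) - (v - w) *\<^sub>C ?x"
    by (simp add: scaleC.diff_left)
  also have "\<dots> = y - (v - w) *\<^sub>C ?x"
    by (simp only: resolvent_solves(2) [OF w UNIV_I])
  finally have "app T ?x - v *\<^sub>C ?x = y - (v - w) *\<^sub>C ?x" .
  then have "?x = resolvent T v (y - (v - w) *\<^sub>C ?x)"
    by (rule resolvent_eqI [OF v resolvent_solves(1) [OF w UNIV_I], symmetric])
  also have "\<dots> = resolvent T v y - (v - w) *\<^sub>C resolvent T v ?x"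
    using bounded_clinear_resolvent [OF T v] by (simp add: R.diff bounded_clinear_def)
  finally show ?thesis
    by (simp add: algebra_simps)
qed

text \<open>A Neumann argument, \<open>T - v = (1 - (v - w) R w) (T - w)\<close>. The explicit constant makes the resolvents
  near \<open>w\<close> uniformly bounded, which is what continuity and differentiability in operator norm need.\<close>

lemma resolvent_set_ball:
  assumes T: "linear_operator T" and w: "w \<in> resolvent_set T"
    and M: "M > 0" "\<And>y. norm (resolvent T w y) \<le> M * norm y"
    and v: "cmod (v - w) * M \<le> 1 / 2"
  shows "v \<in> resolvent_set T" and "norm (resolvent T v y) \<le> 2 * M * norm y"
proof -
  interpret R: bounded_linear "resolvent T w"
    using bounded_clinear_resolvent [OF T w] by (simp add: bounded_clinear_def)
  have bound: "norm x \<le> 2 * M * norm (app T x - v *\<^sub>C x)" if x: "x \<in> domain T" for x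
  proof -
    have "x = resolvent T w (app T x - w *\<^sub>C x)"
      using resolvent_eqI [OF w x] by simp
    also have "app T x - w *\<^sub>C x = (app T x - v *\<^sub>C x) + (v - w) *\<^sub>C x"
      by (simp add: scaleC.diff_left)
    finally have "norm x \<le> M * norm ((app T x - v *\<^sub>C x) + (v - w) *\<^sub>C x)"
      using M(2) by metis
    also have "\<dots> \<le> M * (norm (app T x - v *\<^sub>C x) + cmod (v - w) * norm x)"
      using M(1) norm_triangle_ineq [of "app T x - v *\<^sub>C x" "(v - w) *\<^sub>C x"]
      by (simp add: norm_scaleC)
    also have "\<dots> = M * norm (app T x - v *\<^sub>C x) + (cmod (v - w) * M) * norm x"
      by (simp add: algebra_simps)
    also have "\<dots> \<le> M * norm (app T x - v *\<^sub>C x) + 1 / 2 * norm x"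
      using v by (intro add_left_mono mult_right_mono) auto
    finally show ?thesis by simp
  qed
  show v_in: "v \<in> resolvent_set T"
  proof (rule resolvent_set_onI [OF T _ _ bound])
    fix y :: 'a
    have "norm ((v - w) *\<^sub>C resolvent T w x) \<le> 1 / 2 * norm x" for x
    proof -
      have "norm ((v - w) *\<^sub>C resolvent T w x) \<le> cmod (v - w) * (M * norm x)"
        unfolding norm_scaleC by (intro mult_left_mono M) auto
      also have "\<dots> \<le> 1 / 2 * norm x"
        unfolding mult.assoc [symmetric] by (intro mult_right_mono v) auto
      finally show ?thesis .
    qed
    then obtain u where u: "u - (v - w) *\<^sub>C resolvent T w u = y"
      using identity_minus_contraction_invertible(1) [of "\<lambda>x. (v - w) *\<^sub>C resolvent T w x" "1/2" y]
        bounded_linear_compose [OF scaleC.bounded_linear_right R.bounded_linear] by auto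
    have "app T (resolvent T w u) - v *\<^sub>C resolvent T w u
        = (app T (resolvent T w u) - w *\<^sub>C resolvent T w u) - (v - w) *\<^sub>C resolvent T w u"
      by (simp add: scaleC.diff_left)
    also have "\<dots> = u - (v - w) *\<^sub>C resolvent T w u"
      by (simp only: resolvent_solves(2) [OF w UNIV_I])
    finally have "app T (resolvent T w u) - v *\<^sub>C resolvent T w u = u - (v - w) *\<^sub>C resolvent T w u" .
    then show "\<exists>x\<in>domain T. app T x - v *\<^sub>C x = y"
      using u resolvent_solves(1) [OF w, of u] by auto
  qed auto
  show "norm (resolvent T v y) \<le> 2 * M * norm y"
    using bound [OF resolvent_solves(1) [OF v_in UNIV_I, of y]] by (simp add: resolvent_solves(2) [OF v_in])
qed

lemma open_resolvent_set:
  assumes T: "linear_operator T"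
  shows "open (resolvent_set T)"
  unfolding open_dist
proof
  fix w assume w: "w \<in> resolvent_set T"
  then obtain M where M: "M > 0" "\<And>y. norm (resolvent T w y) \<le> M * norm y"
    using resolvent_bound by blast
  show "\<exists>e>0. \<forall>v. dist v w < e \<longrightarrow> v \<in> resolvent_set T"
  proof (intro exI [of _ "1 / (2 * M)"] conjI allI impI)
    show "v \<in> resolvent_set T" if "dist v w < 1 / (2 * M)" for v
      using that M(1) by (intro resolvent_set_ball(1) [OF T w M]) (simp add: dist_norm field_simps)
  qed (use M in simp)
qed

section \<open>The resolvent as a holomorphic operator-valued function\<close>

definition scale_blinfun :: "complex \<Rightarrow> ('a::chilbert_space \<Rightarrow>\<^sub>L 'a) \<Rightarrow> 'a \<Rightarrow>\<^sub>L 'a" where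
  "scale_blinfun c T = scaleC.prod_right c o\<^sub>L T"

lemma scale_blinfun_apply [simp]: "blinfun_apply (scale_blinfun c T) x = c *\<^sub>C T x"
  by (simp add: scale_blinfun_def)

lemma complex_scaling_scale_blinfun: "complex_scaling scale_blinfun"
proof (rule complex_scaling.intro)
  show "bounded_bilinear (scale_blinfun :: complex \<Rightarrow> ('a \<Rightarrow>\<^sub>L 'a) \<Rightarrow> _)"
    unfolding scale_blinfun_def
    by (rule bounded_bilinear.comp [OF bounded_bilinear_blinfun_compose
          scaleC.bounded_linear_prod_right bounded_linear_ident])
  show "complex_scaling_axioms (scale_blinfun :: complex \<Rightarrow> ('a \<Rightarrow>\<^sub>L 'a) \<Rightarrow> _)"
    by unfold_locales (auto intro!: blinfun_eqI simp: scaleC_scaleC)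
qed

interpretation scale_blinfun: complex_scaling scale_blinfun
  by (rule complex_scaling_scale_blinfun)

lemma norm_scale_blinfun: "norm (scale_blinfun c T) \<le> cmod c * norm T"
proof (rule norm_blinfun_bound)
  show "norm (scale_blinfun c T x) \<le> cmod c * norm T * norm x" for x
    by (simp add: norm_scaleC mult.assoc mult_left_mono norm_blinfun)
qed simp

definition resolvent_blinfun where
  "resolvent_blinfun T w = Blinfun (resolvent T w)"

lemma resolvent_blinfun_apply:
  assumes "linear_operator T" "w \<in> resolvent_set T"
  shows "blinfun_apply (resolvent_blinfun T w) = resolvent T w"
  using bounded_clinear_resolvent [OF assms]
  by (simp add: resolvent_blinfun_def bounded_clinear_def bounded_linear_Blinfun_apply)

text \<open>By the resolvent identity applied twice the remainder is \<open>(v - w)\<^sup>2 R v R w R w\<close>, where \<open>R v\<close> stays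
  bounded near \<open>w\<close>.\<close>

lemma has_derivative_resolvent:
  assumes T: "linear_operator T" and w: "w \<in> resolvent_set T"
  shows "(resolvent_blinfun T has_derivative
    (\<lambda>h. scale_blinfun h (resolvent_blinfun T w o\<^sub>L resolvent_blinfun T w))) (at w)"
proof -
  let ?R = "resolvent_blinfun T"
  obtain M where M: "M > 0" "\<And>y. norm (resolvent T w y) \<le> M * norm y"
    using resolvent_bound [OF w] by blast
  have nw: "norm (?R w) \<le> M"
    using M by (intro norm_blinfun_bound) (auto simp: resolvent_blinfun_apply [OF T w])
  show ?thesis
  proof (rule has_derivativeI_sandwich)
    \<comment> \<open>This radius keeps \<open>v\<close> in the ball where the resolvents are bounded by twice the bound at \<open>w\<close>.\<close>
    show "0 < 1 / (2 * M)" using M by simp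
    show "bounded_linear (\<lambda>h. scale_blinfun h (?R w o\<^sub>L ?R w))"
      by (rule scale_blinfun.bounded_linear_left)
    fix v assume v: "v \<noteq> w" "dist v w < 1 / (2 * M)"
    then have vM: "cmod (v - w) * M \<le> 1 / 2"
      using M(1) by (simp add: dist_norm field_simps)
    note v_in = resolvent_set_ball(1) [OF T w M vM]
    have nv: "norm (?R v) \<le> 2 * M"
      using M resolvent_set_ball(2) [OF T w M vM]
      by (intro norm_blinfun_bound) (auto simp: resolvent_blinfun_apply [OF T v_in])
    have id: "?R v - ?R w = scale_blinfun (v - w) (?R v o\<^sub>L ?R w)"
      by (rule blinfun_eqI)
        (simp add: blinfun.diff_left resolvent_blinfun_apply [OF T] w v_in resolvent_identity [OF T w v_in])
    have "?R v - ?R w - scale_blinfun (v - w) (?R w o\<^sub>L ?R w)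
        = scale_blinfun (v - w) (scale_blinfun (v - w) (?R v o\<^sub>L ?R w) o\<^sub>L ?R w)"
      unfolding id [symmetric]
      by (rule blinfun_eqI) (subst id, simp add: blinfun.diff_left scaleC.diff_right)
    also have "norm \<dots> \<le> cmod (v - w) * (cmod (v - w) * (2 * M * M) * M)"
    proof (intro order_trans [OF norm_scale_blinfun] mult_left_mono)
      have "norm (scale_blinfun (v - w) (?R v o\<^sub>L ?R w)) \<le> cmod (v - w) * (2 * M * M)"
        using M nv nw
        by (intro order_trans [OF norm_scale_blinfun] mult_left_mono
            order_trans [OF norm_blinfun_compose] mult_mono) auto
      then show "norm (scale_blinfun (v - w) (?R v o\<^sub>L ?R w) o\<^sub>L ?R w)
          \<le> cmod (v - w) * (2 * M * M) * M"
        using M nw by (intro order_trans [OF norm_blinfun_compose] mult_mono) auto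
    qed auto
    finally show "norm (?R v - ?R w - scale_blinfun (v - w) (?R w o\<^sub>L ?R w)) / norm (v - w)
        \<le> cmod (v - w) * (2 * M * M) * M"
      using v(1) by (simp add: field_simps)
  next
    show "(\<lambda>v. cmod (v - w) * (2 * M * M) * M) \<midarrow>w\<rightarrow> 0"
      by (auto intro!: tendsto_eq_intros)
  qed
qed

lemma continuous_on_resolvent:
  assumes "linear_operator T"
  shows "continuous_on (resolvent_set T) (resolvent_blinfun T)"
  by (meson assms continuous_at_imp_continuous_on has_derivative_continuous has_derivative_resolvent)

lemma bounded_clinear_scaleC: "bounded_clinear ((*\<^sub>C) c)"
  by (simp add: bounded_clinear_def scaleC.bounded_linear_right scaleC_scaleC mult.commute)

section \<open>The Riesz projection and the reduced resolvent\<close>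

text \<open>Contour integrals of vector-valued functions. Once the integrals exist in operator norm, all
  identities between them are checked after applying both sides to a vector.\<close>

definition has_vec_contour_integral ::
    "(complex \<Rightarrow> 'a::chilbert_space) \<Rightarrow> 'a \<Rightarrow> (real \<Rightarrow> complex) \<Rightarrow> bool" where
  "has_vec_contour_integral g I \<gamma> \<longleftrightarrow>
     ((\<lambda>t. vector_derivative \<gamma> (at t within {0..1}) *\<^sub>C g (\<gamma> t)) has_integral I) {0..1}"

lemma has_vec_contour_integral_linear:
  assumes "bounded_clinear T" "has_vec_contour_integral g I \<gamma>"
  shows "has_vec_contour_integral (\<lambda>w. T (g w)) (T I) \<gamma>"
  using assms has_integral_linear [of _ I "{0..1}" T]
  by (force simp: has_vec_contour_integral_def bounded_clinear_def o_def)

lemma has_vec_contour_integral_add: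
  "has_vec_contour_integral g I \<gamma> \<Longrightarrow> has_vec_contour_integral h J \<gamma> \<Longrightarrow>
    has_vec_contour_integral (\<lambda>w. g w + h w) (I + J) \<gamma>"
  by (simp add: has_vec_contour_integral_def scaleC_add_right has_integral_add)

lemma has_vec_contour_integral_diff:
  "has_vec_contour_integral g I \<gamma> \<Longrightarrow> has_vec_contour_integral h J \<gamma> \<Longrightarrow>
    has_vec_contour_integral (\<lambda>w. g w - h w) (I - J) \<gamma>"
  by (simp add: has_vec_contour_integral_def scaleC.diff_right has_integral_diff)

lemma has_vec_contour_integral_unique:
  "has_vec_contour_integral g I \<gamma> \<Longrightarrow> has_vec_contour_integral h J \<gamma> \<Longrightarrow>
    (\<And>w. w \<in> path_image \<gamma> \<Longrightarrow> g w = h w) \<Longrightarrow> I = J"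
  unfolding has_vec_contour_integral_def path_image_def
  by (rule has_integral_unique, assumption, erule has_integral_eq [rotated]) simp

lemma has_vec_contour_integral_inverse:
  assumes "valid_path \<gamma>" "0 \<notin> path_image \<gamma>" "winding_number \<gamma> 0 = 1"
  shows "has_vec_contour_integral (\<lambda>w. (1 / w) *\<^sub>C x) ((2 * of_real pi * \<i>) *\<^sub>C x) \<gamma>"
proof -
  have "((\<lambda>w. 1 / (w - 0)) has_contour_integral (2 * of_real pi * \<i> * winding_number \<gamma> 0)) \<gamma>"
    using has_contour_integral_winding_number [OF assms(1,2)] by simp
  then have "((\<lambda>t. 1 / \<gamma> t * vector_derivative \<gamma> (at t within {0..1})) has_integral
      2 * of_real pi * \<i>) {0..1}"
    by (simp add: has_contour_integral_def assms(3))
  from has_integral_linear [OF this scaleC.bounded_linear_left [of x]] show ?thesis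
    by (simp add: has_vec_contour_integral_def o_def scaleC_scaleC mult.commute)
qed

lemma scaleC_cancel: "c \<noteq> 0 \<Longrightarrow> c *\<^sub>C x = c *\<^sub>C y \<longleftrightarrow> x = (y::'a::chilbert_space)"
  by (metis left_inverse scaleC_1 scaleC_scaleC)

locale contour_around_zero =
  fixes B :: "'a::chilbert_space unbounded_operator" and \<gamma> :: "real \<Rightarrow> complex"
  assumes linear: "linear_operator B"
    and valid: "valid_path \<gamma>"
    and in_resolvent_set: "path_image \<gamma> \<subseteq> resolvent_set B"
    and not_zero: "0 \<notin> path_image \<gamma>"
    and winding: "winding_number \<gamma> 0 = 1"
begin

text \<open>With \<open>g = 1\<close> this gives the Riesz projection, and with \<open>g w = 1 / w\<close> the reduced resolvent; that the
  integral is the value of a bounded operator gives the continuity of both.\<close>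

lemma weighted_resolvent_integral:
  assumes g: "\<And>w. w \<noteq> 0 \<Longrightarrow> (g has_field_derivative g' w) (at w)"
    and g': "continuous_on (- {0}) g'"
  defines "G \<equiv> \<lambda>t. scale_blinfun (vector_derivative \<gamma> (at t within {0..1}))
      (scale_blinfun (g (\<gamma> t)) (resolvent_blinfun B (\<gamma> t)))"
  shows "has_vec_contour_integral (\<lambda>w. g w *\<^sub>C resolvent B w x) (blinfun_apply (integral {0..1} G) x) \<gamma>"
proof -
  let ?U = "resolvent_set B - {0}" and ?R = "resolvent_blinfun B"
  have cR: "continuous_on ?U ?R"
    using continuous_on_resolvent [OF linear] by (rule continuous_on_subset) auto
  have cg: "continuous_on ?U g" "continuous_on ?U g'"
    using g by (auto intro!: continuous_at_imp_continuous_on DERIV_isCont continuous_on_subset [OF g'])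
  have "G integrable_on {0..1}"
    unfolding G_def
  proof (rule scale_blinfun.path_integrable [OF valid])
    show "path_image \<gamma> \<subseteq> ?U"
      using in_resolvent_set not_zero by auto
    show "open ?U"
      using open_resolvent_set [OF linear] by auto
    show "((\<lambda>w. scale_blinfun (g w) (?R w)) has_derivative
        (\<lambda>h. scale_blinfun h (scale_blinfun (g w) (?R w o\<^sub>L ?R w) + scale_blinfun (g' w) (?R w)))) (at w)"
      if "w \<in> ?U" for w
      using that by (intro scale_blinfun.has_derivative_scaled has_derivative_resolvent linear g) auto
    show "continuous_on ?U (\<lambda>w. scale_blinfun (g w) (?R w o\<^sub>L ?R w) + scale_blinfun (g' w) (?R w))"
      by (intro continuous_on_add scale_blinfun.continuous_on cg cR
          bounded_bilinear.continuous_on [OF bounded_bilinear_blinfun_compose])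
  qed
  then have "(G has_integral integral {0..1} G) {0..1}"
    by (rule integrable_integral)
  from has_integral_linear [OF this blinfun.bounded_linear_left [of x]]
  have "((\<lambda>t. blinfun_apply (G t) x) has_integral blinfun_apply (integral {0..1} G) x) {0..1}"
    by (simp add: o_def)
  then show ?thesis
    unfolding has_vec_contour_integral_def
  proof (rule has_integral_eq [rotated])
    fix t :: real assume "t \<in> {0..1}"
    then have "\<gamma> t \<in> resolvent_set B"
      using in_resolvent_set by (auto simp: path_image_def)
    then show "blinfun_apply (G t) x
        = vector_derivative \<gamma> (at t within {0..1}) *\<^sub>C g (\<gamma> t) *\<^sub>C resolvent B (\<gamma> t) x"
      by (simp add: G_def resolvent_blinfun_apply [OF linear])
  qed
qed

definition riesz where "riesz = riesz_projection B \<gamma>"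

lemma riesz_integral:
  shows "has_vec_contour_integral (\<lambda>w. resolvent B w x) (- ((2 * of_real pi * \<i>) *\<^sub>C riesz x)) \<gamma>"
    and "bounded_linear riesz"
proof -
  let ?G = "\<lambda>t. scale_blinfun (vector_derivative \<gamma> (at t within {0..1}))
      (scale_blinfun 1 (resolvent_blinfun B (\<gamma> t)))"
  have "Blinfun (\<lambda>y. vector_derivative \<gamma> (at t within {0..1}) *\<^sub>C (- resolvent B (\<gamma> t) y)) = - ?G t"
    if "t \<in> {0..1}" for t
  proof -
    have "\<gamma> t \<in> resolvent_set B"
      using in_resolvent_set that by (auto simp: path_image_def)
    then have "blinfun_apply (- ?G t)
        = (\<lambda>y. vector_derivative \<gamma> (at t within {0..1}) *\<^sub>C (- resolvent B (\<gamma> t) y))"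
      by (simp add: fun_eq_iff blinfun.minus_left resolvent_blinfun_apply [OF linear] scaleC.minus_right)
    then show ?thesis
      by (metis blinfun_apply_inverse)
  qed
  then have "integral {0..1} (\<lambda>t. Blinfun (\<lambda>y. vector_derivative \<gamma> (at t within {0..1}) *\<^sub>C (- resolvent B (\<gamma> t) y)))
      = - integral {0..1} ?G"
    by (subst integral_neg [symmetric]) (rule integral_cong)
  then have riesz: "riesz x
      = (1 / (2 * complex_of_real pi * \<i>)) *\<^sub>C (- blinfun_apply (integral {0..1} ?G) x)" for x
    by (simp add: riesz_def riesz_projection_def blinfun.minus_left)
  then have "blinfun_apply (integral {0..1} ?G) x = - ((2 * of_real pi * \<i>) *\<^sub>C riesz x)"
    by (simp add: scaleC_scaleC)
  then show "has_vec_contour_integral (\<lambda>w. resolvent B w x) (- ((2 * of_real pi * \<i>) *\<^sub>C riesz x)) \<gamma>"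
    using weighted_resolvent_integral [of "\<lambda>_. 1" "\<lambda>_. 0" x] by simp
  show "bounded_linear riesz"
    unfolding riesz [abs_def]
    by (intro bounded_linear_compose [OF scaleC.bounded_linear_right] bounded_linear_minus
        blinfun.bounded_linear_right)
qed

lemma bounded_clinear_riesz: "bounded_clinear riesz"
proof -
  have "- ((2 * of_real pi * \<i>) *\<^sub>C riesz (c *\<^sub>C x)) = c *\<^sub>C (- ((2 * of_real pi * \<i>) *\<^sub>C riesz x))" for c x
    using in_resolvent_set bounded_clinear_resolvent [OF linear]
    by (intro has_vec_contour_integral_unique [OF riesz_integral(1)
          has_vec_contour_integral_linear [OF bounded_clinear_scaleC riesz_integral(1)]])
      (auto simp: bounded_clinear_def)
  then have "(2 * of_real pi * \<i>) *\<^sub>C riesz (c *\<^sub>C x) = (2 * of_real pi * \<i>) *\<^sub>C (c *\<^sub>C riesz x)" for c x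
    by (simp add: scaleC.minus_right scaleC_scaleC mult.commute)
  then show ?thesis
    by (simp add: bounded_clinear_def riesz_integral(2) scaleC_cancel)
qed

text \<open>The operator \<open>S = (1 / 2\<pi>i) \<integral> R w / w dw\<close> (for a small circle around an isolated spectral point, the
  constant term of the Laurent expansion of the resolvent) inverts \<open>B\<close> up to \<open>P\<close>: for \<open>x\<close> in the domain, \<open>R w (B x) / w = x / w + R w x\<close>
  integrates to \<open>S B x = x - P x\<close>. For the other order the unbounded \<open>B\<close> must not be pulled through
  the integral. Instead \<open>R w y / w = R l (y / w + R w y - l R w y / w)\<close>, with a fixed bounded
  resolvent \<open>R l\<close>, integrates to \<open>S y = R l (y - P y - l S y)\<close>; applying \<open>B - l\<close> gives
  \<open>B S y = y - P y\<close>.\<close>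

lemma reduced_resolvent:
  obtains S where "bounded_linear S"
    and "\<And>y. S y \<in> domain B" and "\<And>y. app B (S y) = y - riesz y"
    and "\<And>x. x \<in> domain B \<Longrightarrow> S (app B x) = x - riesz x"
proof -
  let ?c = "2 * complex_of_real pi * \<i>"
  define E where "E = integral {0..1} (\<lambda>t. scale_blinfun (vector_derivative \<gamma> (at t within {0..1}))
      (scale_blinfun (1 / \<gamma> t) (resolvent_blinfun B (\<gamma> t))))"
  define S where "S x = (1 / ?c) *\<^sub>C blinfun_apply E x" for x
  have S_lin: "bounded_linear S"
    unfolding S_def [abs_def]
    by (intro bounded_linear_compose [OF scaleC.bounded_linear_right] blinfun.bounded_linear_right)
  have S: "has_vec_contour_integral (\<lambda>w. (1 / w) *\<^sub>C resolvent B w x) (?c *\<^sub>C S x) \<gamma>" for x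
    using weighted_resolvent_integral [of "\<lambda>w. 1 / w" "\<lambda>w. - 1 / w\<^sup>2" x]
    unfolding S_def E_def scaleC_scaleC
    by (force intro!: derivative_eq_intros continuous_intros simp: power2_eq_square)
  note inverse = has_vec_contour_integral_inverse [OF valid not_zero winding]
  have S_B: "S (app B x) = x - riesz x" if x: "x \<in> domain B" for x
  proof -
    have "?c *\<^sub>C S (app B x) = ?c *\<^sub>C x + - (?c *\<^sub>C riesz x)"
    proof (rule has_vec_contour_integral_unique
        [OF S has_vec_contour_integral_add [OF inverse riesz_integral(1)]])
      fix w assume w: "w \<in> path_image \<gamma>"
      then have w': "w \<in> resolvent_set B" "w \<noteq> 0"
        using in_resolvent_set not_zero by auto
      interpret R: bounded_linear "resolvent B w"
        using bounded_clinear_resolvent [OF linear w'(1)] by (simp add: bounded_clinear_def)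
      have "app B x = (app B x - w *\<^sub>C x) + w *\<^sub>C x"
        by simp
      then have "resolvent B w (app B x) = resolvent B w (app B x - w *\<^sub>C x) + w *\<^sub>C resolvent B w x"
        using bounded_clinear_resolvent [OF linear w'(1)] by (metis R.add bounded_clinear_def)
      then have "resolvent B w (app B x) = x + w *\<^sub>C resolvent B w x"
        by (simp only: resolvent_eqI [OF w'(1) x refl])
      then show "(1 / w) *\<^sub>C resolvent B w (app B x) = (1 / w) *\<^sub>C x + resolvent B w x"
        using w'(2) by (simp add: scaleC_add_right scaleC_scaleC)
    qed
    then have "?c *\<^sub>C S (app B x) = ?c *\<^sub>C (x - riesz x)"
      by (simp add: scaleC.diff_right)
    then show ?thesis
      by (simp add: scaleC_cancel)
  qed
  obtain l where l: "l \<in> resolvent_set B"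
    using in_resolvent_set by (force simp: path_image_def)
  have S_eq: "S y = resolvent B l (y - riesz y - l *\<^sub>C S y)" for y
  proof -
    note R = bounded_clinear_resolvent [OF linear l]
    interpret R: bounded_linear "resolvent B l"
      using R by (simp add: bounded_clinear_def)
    have "?c *\<^sub>C S y = resolvent B l (?c *\<^sub>C y + - (?c *\<^sub>C riesz y) - l *\<^sub>C ?c *\<^sub>C S y)"
    proof (rule has_vec_contour_integral_unique [OF S has_vec_contour_integral_linear
          [OF R has_vec_contour_integral_diff [OF has_vec_contour_integral_add [OF inverse riesz_integral(1)]
            has_vec_contour_integral_linear [OF bounded_clinear_scaleC S]]]])
      fix w assume w: "w \<in> path_image \<gamma>"
      then have w': "w \<in> resolvent_set B" "w \<noteq> 0"
        using in_resolvent_set not_zero by auto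
      let ?x = "resolvent B w y"
      have "resolvent B l y - ?x = (l - w) *\<^sub>C resolvent B l ?x"
        by (rule resolvent_identity [OF linear w'(1) l])
      then have eq: "?x = resolvent B l y + w *\<^sub>C resolvent B l ?x - l *\<^sub>C resolvent B l ?x"
        by (simp add: scaleC.diff_left algebra_simps)
      have "(1 / w) *\<^sub>C ?x = (1 / w) *\<^sub>C (resolvent B l y + w *\<^sub>C resolvent B l ?x - l *\<^sub>C resolvent B l ?x)"
        using eq by (rule arg_cong)
      also have "\<dots> = resolvent B l ((1 / w) *\<^sub>C y + ?x - l *\<^sub>C (1 / w) *\<^sub>C ?x)"
        using R w'(2) by (simp add: scaleC_add_right scaleC.diff_right scaleC_scaleC R.add R.diff
            bounded_clinear_def mult.commute)
      finally show "(1 / w) *\<^sub>C ?x = resolvent B l ((1 / w) *\<^sub>C y + ?x - l *\<^sub>C (1 / w) *\<^sub>C ?x)" .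
    qed
    also have "\<dots> = resolvent B l (?c *\<^sub>C (y - riesz y - l *\<^sub>C S y))"
      by (simp add: scaleC.diff_right scaleC_scaleC mult.commute)
    also have "\<dots> = ?c *\<^sub>C resolvent B l (y - riesz y - l *\<^sub>C S y)"
      using R by (simp add: bounded_clinear_def)
    finally show ?thesis
      by (simp add: scaleC_cancel)
  qed
  have S_dom: "S y \<in> domain B" for y
    using resolvent_solves(1) [OF l UNIV_I] S_eq by metis
  have "app B (S y) - l *\<^sub>C S y = y - riesz y - l *\<^sub>C S y" for y
    using resolvent_solves(2) [OF l UNIV_I] S_eq by metis
  then have "app B (S y) = y - riesz y" for y
    by (metis diff_eq_eq diff_add_cancel)
  then show thesis
    using that S_lin S_dom S_B by blast
qed

end

section \<open>Bounded operators built from a pencil\<close>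

lemma bounded_clinear_simps:
  assumes "bounded_clinear f"
  shows "bounded_linear f" "f (x + y) = f x + f y" "f (x - y) = f x - f y" "f 0 = 0"
    "f (c *\<^sub>C x) = c *\<^sub>C f x"
  using assms
  by (auto simp: bounded_clinear_def linear_simps)

lemma linear_operator_on_range:
  assumes "bounded_clinear V" "bounded_clinear P"
  shows "linear_operator \<lparr>domain = range P, app = V\<rparr>"
proof -
  have "0 \<in> range P" "P x + P y \<in> range P" "c *\<^sub>C P x \<in> range P" for x y c
    by (metis bounded_clinear_simps(4) [OF assms(2)] rangeI,
        metis bounded_clinear_simps(2) [OF assms(2)] rangeI,
        metis bounded_clinear_simps(5) [OF assms(2)] rangeI)
  then show ?thesis
    using assms(1) by (auto simp: linear_operator_def bounded_clinear_simps)
qed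

text \<open>Solving \<open>(V - z) x = y\<close> in the whole space suffices: the solution \<open>x = (V x - y) / z\<close> lies in the
  range of \<open>P\<close> as soon as \<open>y\<close> does. Taking the identity for \<open>P\<close> covers operators on the whole space.\<close>

lemma outside_onorm_in_resolvent_set:
  assumes V: "bounded_clinear V" and P: "bounded_clinear P"
    and V_range: "range V \<subseteq> range P" and z: "onorm V < cmod z"
  shows "z \<in> resolvent_set_on (range P) \<lparr>domain = range P, app = V\<rparr>"
proof -
  note V_simps = bounded_clinear_simps [OF V] and P_simps = bounded_clinear_simps [OF P]
  define q where "q = onorm V / cmod z"
  have z0: "0 < cmod z" and q: "0 \<le> q" "q < 1"
    using z onorm_pos_le [OF V_simps(1)] by (auto simp: q_def divide_less_eq)
  define T where "T x = (1 / z) *\<^sub>C V x" for x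
  have T: "bounded_linear T"
    unfolding T_def [abs_def]
    by (intro bounded_linear_compose [OF scaleC.bounded_linear_right] V_simps)
  have Tq: "norm (T x) \<le> q * norm x" for x
    using onorm [OF V_simps(1), of x] z0 by (simp add: T_def q_def norm_scaleC norm_divide field_simps)
  have eq: "V x - z *\<^sub>C x = (- z) *\<^sub>C (x - T x)" for x
    using z0 by (simp add: T_def scaleC.diff_right scaleC.minus_left scaleC_scaleC)
  show ?thesis
  proof (rule resolvent_set_onI [OF linear_operator_on_range [OF V P]])
    fix x assume "x \<in> domain \<lparr>domain = range P, app = V\<rparr>"
    then obtain v x' where "V x = P v" "x = P x'"
      using V_range by simp blast
    then have "V x - z *\<^sub>C x = P (v - z *\<^sub>C x')"
      by (simp add: P_simps)
    then show "app \<lparr>domain = range P, app = V\<rparr> x - z *\<^sub>C x \<in> range P"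
      by simp
  next
    fix y assume "y \<in> range P"
    obtain x where x: "x - T x = (- (1 / z)) *\<^sub>C y"
      using identity_minus_contraction_invertible(1) [OF T Tq q] by blast
    have "x = T x - (1 / z) *\<^sub>C y"
      using x by (simp add: scaleC.minus_left algebra_simps)
    also have "\<dots> = (1 / z) *\<^sub>C (V x - 1 *\<^sub>C y)"
      by (simp add: T_def scaleC.diff_right)
    finally have "x = (1 / z) *\<^sub>C (V x - 1 *\<^sub>C y)" .
    moreover obtain v y' where "V x = P v" "y = P y'"
      using V_range \<open>y \<in> range P\<close> by blast
    ultimately have "x = P ((1 / z) *\<^sub>C (v - y'))"
      by (simp add: P_simps)
    then have "x \<in> range P"
      by blast
    moreover have "V x - z *\<^sub>C x = y"
      using z0 by (simp add: eq x scaleC_scaleC)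
    ultimately show "\<exists>x\<in>domain \<lparr>domain = range P, app = V\<rparr>.
        app \<lparr>domain = range P, app = V\<rparr> x - z *\<^sub>C x = y"
      by auto
  next
    fix x
    show "norm x \<le> (1 / (cmod z * (1 - q))) * norm (app \<lparr>domain = range P, app = V\<rparr> x - z *\<^sub>C x)"
      using identity_minus_contraction_invertible(2) [OF T Tq q, of x] z0 by (simp add: eq norm_scaleC)
  qed
qed

lemma linear_operator_op_pencil:
  assumes A: "linear_operator A" and B: "linear_operator B" and sub: "domain B \<subseteq> domain A"
  shows "linear_operator (op_pencil A B \<beta>)"
  unfolding op_pencil_def linear_operator_def
  using sub by (auto simp: subset_iff linear_operator_simps [OF A] linear_operator_simps [OF B]
      scaleC_add_right scaleC_scaleC mult.commute)

lemma bounded_linear_relatively_bounded_compose: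
  assumes A: "linear_operator A" and rb: "relatively_bounded A B"
    and T: "bounded_linear T" "\<And>x. T x \<in> domain B" and BT: "bounded_linear (\<lambda>x. app B (T x))"
  shows "bounded_linear (\<lambda>x. app A (T x))"
proof -
  obtain a b where a: "a \<ge> 0" and b: "b \<ge> 0"
    and ab: "\<And>x. x \<in> domain B \<Longrightarrow> norm (app A x) \<le> a * norm (app B x) + b * norm x"
    and sub: "domain B \<subseteq> domain A"
    using rb by (auto simp: relatively_bounded_def)
  have dom: "T x \<in> domain A" for x
    using T(2) sub by blast
  interpret T: bounded_linear T by (rule T(1))
  obtain K1 K2 where K: "\<And>x. norm (T x) \<le> norm x * K1" "\<And>x. norm (app B (T x)) \<le> norm x * K2"
    using T.bounded bounded_linear.bounded [OF BT] by blast
  show ?thesis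
  proof (rule bounded_linear_intro)
    show "app A (T (x + y)) = app A (T x) + app A (T y)" for x y
      by (simp add: T.add linear_operator_simps(2) [OF A] dom)
    show "app A (T (r *\<^sub>R x)) = r *\<^sub>R app A (T x)" for r x
      using linear_operator_simps(4) [OF A dom, of "complex_of_real r" x]
      by (simp add: T.scaleR scaleC_of_real)
    show "norm (app A (T x)) \<le> norm x * (a * K2 + b * K1)" for x
    proof -
      have "norm (app A (T x)) \<le> a * norm (app B (T x)) + b * norm (T x)"
        by (rule ab [OF T(2)])
      also have "\<dots> \<le> a * (norm x * K2) + b * (norm x * K1)"
        using a b K by (intro add_mono mult_left_mono)
      finally show ?thesis by (simp add: algebra_simps)
    qed
  qed
qed

section \<open>Large coupling asymptotics of the resolvent\<close>

text \<open>The algebraic outcome of the spectral assumptions on \<open>B\<close>: \<open>P\<close> is a projection onto the kernel of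
  \<open>B\<close>, and \<open>S\<close> vanishes on the range of \<open>P\<close> and inverts \<open>B\<close> on the complement.\<close>

locale decoupled_pencil =
  fixes A B :: "'a::chilbert_space unbounded_operator" and P S :: "'a \<Rightarrow> 'a"
  assumes A: "linear_operator A" and B: "linear_operator B" and rb: "relatively_bounded A B"
    and P: "bounded_clinear P" and P_idem: "P (P x) = P x"
    and P_dom: "P x \<in> domain B" and B_P: "app B (P x) = 0"
    and S: "bounded_linear S" and S_dom: "S x \<in> domain B" and B_S: "app B (S x) = x - P x"
    and P_S: "P (S x) = 0" and S_P: "S (P x) = 0"
    and S_B: "x \<in> domain B \<Longrightarrow> S (app B x) = x - P x"
begin

lemmas A_simps = linear_operator_simps [OF A]
  and B_simps = linear_operator_simps [OF B]
  and P_simps = bounded_clinear_simps [OF P]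

sublocale S: bounded_linear S by (rule S)

lemma dom_subset: "x \<in> domain B \<Longrightarrow> x \<in> domain A"
  using rb by (auto simp: relatively_bounded_def)

lemma P_B: assumes x: "x \<in> domain B" shows "P (app B x) = 0"
proof -
  have "app B x = app B (x - P x)"
    by (simp add: B_simps(6) [OF x P_dom] B_P)
  then have "app B x = app B x - P (app B x)"
    using B_S S_B [OF x] by metis
  then show ?thesis by simp
qed

abbreviation AP where "AP \<equiv> \<lambda>x. app A (P x)"
abbreviation PAP where "PAP \<equiv> \<lambda>x. P (app A (P x))"

lemma bounded_clinear_AP: "bounded_clinear AP"
  unfolding bounded_clinear_def
  using bounded_linear_relatively_bounded_compose [OF A rb P_simps(1) P_dom]
  by (simp add: B_P P_simps(5) A_simps(4) dom_subset [OF P_dom])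

lemma bounded_clinear_PAP: "bounded_clinear PAP"
  using bounded_clinear_AP P
  by (simp add: bounded_clinear_def bounded_linear_compose [of P AP])

context
  fixes z assumes z: "onorm PAP < cmod z"
begin

lemma z_in: "z \<in> resolvent_set \<lparr>domain = UNIV, app = PAP\<rparr>"
  using outside_onorm_in_resolvent_set [OF bounded_clinear_PAP, of "\<lambda>x. x"] z
  by (simp add: bounded_clinear_def)

lemma z_in_range: "z \<in> resolvent_set_on (range P) \<lparr>domain = range P, app = PAP\<rparr>"
  using outside_onorm_in_resolvent_set [OF bounded_clinear_PAP P _ z] by auto

text \<open>The limit \<open>P (PAP - z)\<^sup>-\<^sup>1 P\<close>. The outer \<open>P\<close> can be left out (lemma \<open>P_X\<close>), and by lemma
  \<open>resolvent_range_eq\<close> it does not matter whether \<open>PAP\<close> is inverted in the whole space or in the range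
  of \<open>P\<close>.\<close>

definition X where "X x = resolvent \<lparr>domain = UNIV, app = PAP\<rparr> z (P x)"

lemma resolvent_range_eq:
  "resolvent \<lparr>domain = range P, app = PAP\<rparr> z (P x) = X x"
proof -
  let ?x = "resolvent \<lparr>domain = range P, app = PAP\<rparr> z (P x)"
  have "PAP ?x - z *\<^sub>C ?x = P x"
    using resolvent_solves(2) [OF z_in_range, of "P x"] by simp
  then show ?thesis
    unfolding X_def by (intro resolvent_eqI [OF z_in, symmetric]) auto
qed

lemma P_X: "P (X x) = X x"
  using resolvent_solves(1) [OF z_in_range, of "P x"] P_idem by (auto simp: resolvent_range_eq)

lemma PAX: "P (app A (X x)) = z *\<^sub>C X x + P x"
  using resolvent_solves(2) [OF z_in, of "P x"]
  by (simp add: X_def [symmetric] P_X diff_eq_eq add.commute)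

lemma X_eqI: "P x = x \<Longrightarrow> PAP x - z *\<^sub>C x = P y \<Longrightarrow> X y = x"
  unfolding X_def by (rule resolvent_eqI [OF z_in]) auto

lemma bounded_linear_X: "bounded_linear X"
  unfolding X_def [abs_def]
  using bounded_clinear_resolvent [OF _ z_in] linear_operator_on_range [OF bounded_clinear_PAP, of "\<lambda>x. x"]
  by (intro bounded_linear_compose [OF _ P_simps(1)]) (simp add: bounded_clinear_def)

lemma bounded_linear_AX: "bounded_linear (\<lambda>x. app A (X x))"
  using bounded_linear_compose [OF bounded_clinear_simps(1) [OF bounded_clinear_AP] bounded_linear_X]
  by (simp add: P_X)

text \<open>The coupling \<open>(1 - P) A X\<close> from the range of \<open>P\<close> to its complement. It does not become small with
  \<open>1 / \<beta>\<close>, so the approximate inverse has to remove it exactly, which \<open>1 - N\<close> does because \<open>N N = 0\<close>.\<close>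

definition N where "N x = app A (X x) - P (app A (X x))"

lemma bounded_linear_N: "bounded_linear N"
  unfolding N_def [abs_def]
  by (intro bounded_linear_sub bounded_linear_AX bounded_linear_compose [OF P_simps(1)])

lemma P_N: "P (N x) = 0"
  by (simp add: N_def P_simps P_idem)

text \<open>The approximate inverse of \<open>A + \<beta> B - z\<close>, and the operator \<open>L\<close> whose multiple \<open>L / \<beta>\<close> is its error.\<close>

definition G where "G \<beta> x = X x + (1 / \<beta>) *\<^sub>R S (x - N x)"

definition L where "L x = app A (S (x - N x)) - z *\<^sub>C S (x - N x)"

lemma bounded_linear_SN: "bounded_linear (\<lambda>x. S (x - N x))"
  by (intro bounded_linear_compose [OF S] bounded_linear_sub bounded_linear_ident bounded_linear_N)

lemma bounded_linear_G: "bounded_linear (G \<beta>)"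
  unfolding G_def [abs_def]
  by (intro bounded_linear_add bounded_linear_X bounded_linear_const_scaleR bounded_linear_SN)

lemma bounded_linear_L: "bounded_linear L"
  unfolding L_def [abs_def]
proof (intro bounded_linear_sub bounded_linear_SN bounded_linear_compose [OF scaleC.bounded_linear_right])
  show "bounded_linear (\<lambda>x. app A (S (x - N x)))"
    by (rule bounded_linear_relatively_bounded_compose [OF A rb bounded_linear_SN S_dom])
      (simp add: B_S, intro bounded_linear_sub bounded_linear_ident bounded_linear_N
        bounded_linear_compose [OF P_simps(1)])
qed

lemma X_dom: "X x \<in> domain B" and B_X: "app B (X x) = 0"
  using P_dom [of "X x"] B_P [of "X x"] by (simp_all add: P_X)

lemma G_dom: "G \<beta> x \<in> domain B"
  unfolding G_def scaleC_of_real [symmetric]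
  by (intro B_simps X_dom S_dom)

text \<open>As \<open>B X = 0\<close> and \<open>(1/\<beta>) \<beta> B S = 1 - P\<close>, the terms of order \<open>1\<close> are \<open>(A - z) X = N + P\<close> and
  \<open>(1 - P) (1 - N) = 1 - P - N\<close>, whose sum is the identity.\<close>

lemma pencil_G:
  assumes "\<beta> > 0"
  shows "app (op_pencil A B \<beta>) (G \<beta> x) - z *\<^sub>C G \<beta> x = x + (1 / \<beta>) *\<^sub>R L x"
proof -
  let ?s = "S (x - N x)" and ?e = "complex_of_real (1 / \<beta>)"
  have G: "G \<beta> x = X x + ?e *\<^sub>C ?s"
    by (simp only: G_def scaleC_of_real)
  have dB: "X x \<in> domain B" "?s \<in> domain B" "?e *\<^sub>C ?s \<in> domain B"
    by (intro B_simps X_dom S_dom)+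
  have "app A (G \<beta> x) = app A (X x) + ?e *\<^sub>C app A ?s"
    unfolding G using dB dom_subset by (simp add: A_simps)
  moreover have "complex_of_real \<beta> *\<^sub>C app B (G \<beta> x) = x - N x - P x"
    unfolding G using dB assms
    by (simp add: B_simps B_X B_S P_simps P_N scaleC_scaleC flip: of_real_mult)
  ultimately have "app (op_pencil A B \<beta>) (G \<beta> x) - z *\<^sub>C G \<beta> x
      = app A (X x) + ?e *\<^sub>C app A ?s + (x - N x - P x) - (z *\<^sub>C X x + ?e *\<^sub>C z *\<^sub>C ?s)"
    by (simp add: op_pencil_def G scaleC_add_right scaleC_scaleC mult.commute)
  also have "app A (X x) = N x + (z *\<^sub>C X x + P x)"
    by (simp add: N_def flip: PAX)
  finally show ?thesis
    by (simp add: L_def scaleC.diff_right algebra_simps flip: scaleC_of_real)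
qed

text \<open>A right inverse only gives surjectivity of \<open>A + \<beta> B - z\<close>. Injectivity follows because every vector
  of the domain is some \<open>G y\<close>, and on these the pencil acts as the injective \<open>1 + L / \<beta>\<close>.\<close>

lemma G_surj:
  assumes x: "x \<in> domain B" and \<beta>: "\<beta> > 0"
  obtains y where "G \<beta> y = x"
proof -
  \<comment> \<open>The component \<open>P y\<close> is forced by \<open>X y = P x\<close>, the other one by \<open>S (y - N y) / \<beta> = x - P x\<close>.\<close>
  define y0 where "y0 = PAP (P x) - z *\<^sub>C P x"
  define y where "y = y0 + \<beta> *\<^sub>R app B x + N y0"
  have P_y0: "P y0 = y0"
    by (simp add: y0_def P_simps P_idem)
  have P_y: "P y = y0"
    unfolding y_def scaleC_of_real [symmetric]
    by (simp add: P_simps P_y0 P_B [OF x] P_N scaleC.zero_right)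
  have X: "X y0 = P x" "X y = P x"
    by (rule X_eqI; simp add: P_y P_y0 P_idem; simp add: y0_def P_idem)+
  then have "N y = N y0"
    by (simp add: N_def)
  then have "S (y - N y) = S y0 + \<beta> *\<^sub>R (x - P x)"
    by (simp add: y_def S.add S.scaleR S_B [OF x])
  also have "S y0 = 0"
    using S_P [of y0] by (simp add: P_y0)
  finally have "G \<beta> y = x"
    using \<beta> by (simp add: G_def X)
  then show thesis
    using that by blast
qed

text \<open>With \<open>u = (1 + L / \<beta>)\<^sup>-\<^sup>1 y\<close> the resolvent is \<open>G u\<close>, and \<open>y = u + L u / \<beta>\<close> turns the difference from the limit
  into \<open>G u - X y = (S (u - N u) - X (L u)) / \<beta>\<close>, where the norm of \<open>u\<close> is at most twice that of \<open>y\<close>.\<close>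

lemma pencil_resolvent:
  obtains C where "C \<ge> 0"
    and "\<forall>\<^sub>F \<beta> in at_top. z \<in> resolvent_set (op_pencil A B \<beta>)"
    and "\<forall>\<^sub>F \<beta> in at_top. \<forall>y. norm (resolvent (op_pencil A B \<beta>) z y - X y) \<le> C / \<beta> * norm y"
proof -
  interpret X: bounded_linear X by (rule bounded_linear_X)
  obtain l where l: "l > 0" "\<And>x. norm (L x) \<le> norm x * l"
    using bounded_linear.pos_bounded [OF bounded_linear_L] by blast
  have "bounded_linear (\<lambda>x. S (x - N x) - X (L x))"
    by (intro bounded_linear_sub bounded_linear_SN bounded_linear_compose [OF bounded_linear_X] bounded_linear_L)
  then obtain k where k: "k > 0" "\<And>x. norm (S (x - N x) - X (L x)) \<le> norm x * k"
    using bounded_linear.pos_bounded by blast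
  have main: "z \<in> resolvent_set (op_pencil A B \<beta>) \<and>
      (\<forall>y. norm (resolvent (op_pencil A B \<beta>) z y - X y) \<le> 2 * k / \<beta> * norm y)"
    if "\<beta> \<ge> 2 * l" for \<beta>
  proof -
    have \<beta>: "\<beta> > 0" using that l(1) by linarith
    \<comment> \<open>For \<open>\<beta> \<ge> 2 l\<close> the error \<open>L / \<beta>\<close> has norm at most \<open>1 / 2\<close>.\<close>
    define T where "T x = - ((1 / \<beta>) *\<^sub>R L x)" for x
    have T: "bounded_linear T"
      unfolding T_def [abs_def]
      by (intro bounded_linear_minus bounded_linear_const_scaleR bounded_linear_L)
    have T_half: "norm (T x) \<le> 1 / 2 * norm x" for x
    proof -
      have "norm (T x) \<le> (1 / \<beta>) * (norm x * l)"
        using \<beta> l(2) [of x] by (simp add: T_def divide_right_mono)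
      also have "\<dots> = (l / \<beta>) * norm x" by simp
      also have "\<dots> \<le> 1 / 2 * norm x"
        using that \<beta> by (intro mult_right_mono) (auto simp: field_simps)
      finally show ?thesis .
    qed
    note solve = identity_minus_contraction_invertible [OF T T_half]
    have pencil: "app (op_pencil A B \<beta>) (G \<beta> x) - z *\<^sub>C G \<beta> x = x - T x" for x
      using pencil_G [OF \<beta>] by (simp add: T_def)
    have norm_u: "norm u \<le> 2 * norm (u - T u)" for u
      using solve(2) [of u] by simp
    obtain g where g: "g > 0" "\<And>x. norm (G \<beta> x) \<le> norm x * g"
      using bounded_linear.pos_bounded [OF bounded_linear_G] by blast
    have z_pencil: "z \<in> resolvent_set (op_pencil A B \<beta>)"
    proof (rule resolvent_set_onI [OF linear_operator_op_pencil [OF A B]])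
      show "domain B \<subseteq> domain A"
        using dom_subset by blast
    next
      fix y
      obtain u where "u - T u = y"
        using solve(1) by auto
      then show "\<exists>x\<in>domain (op_pencil A B \<beta>). app (op_pencil A B \<beta>) x - z *\<^sub>C x = y"
        using pencil [of u] G_dom [of \<beta> u] by (auto simp: op_pencil_def)
    next
      fix x assume "x \<in> domain (op_pencil A B \<beta>)"
      then obtain u where u: "G \<beta> u = x"
        using G_surj [OF _ \<beta>] by (auto simp: op_pencil_def)
      have "norm x \<le> norm u * g"
        using g(2) u by blast
      also have "\<dots> \<le> 2 * norm (u - T u) * g"
        using norm_u g(1) by (intro mult_right_mono) auto
      finally show "norm x \<le> (2 * g) * norm (app (op_pencil A B \<beta>) x - z *\<^sub>C x)"
        using pencil [of u] by (simp add: u mult.commute mult.left_commute)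
    qed auto
    moreover have "norm (resolvent (op_pencil A B \<beta>) z y - X y) \<le> 2 * k / \<beta> * norm y" for y
    proof -
      obtain u where u: "u - T u = y"
        using solve(1) by auto
      have "resolvent (op_pencil A B \<beta>) z y = G \<beta> u"
        using pencil [of u] G_dom [of \<beta> u] u
        by (intro resolvent_eqI [OF z_pencil]) (auto simp: op_pencil_def)
      moreover have "X y = X u + (1 / \<beta>) *\<^sub>R X (L u)"
        by (simp add: T_def X.add X.scaleR flip: u)
      ultimately have "resolvent (op_pencil A B \<beta>) z y - X y = (1 / \<beta>) *\<^sub>R (S (u - N u) - X (L u))"
        by (simp add: G_def scaleR_diff_right)
      then have "norm (resolvent (op_pencil A B \<beta>) z y - X y) \<le> (1 / \<beta>) * (norm u * k)"
        using \<beta> k(2) [of u] by (simp add: divide_right_mono)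
      also have "\<dots> \<le> (1 / \<beta>) * (2 * norm y * k)"
        using norm_u [of u] u \<beta> k(1) by (intro mult_left_mono mult_right_mono) auto
      finally show ?thesis by (simp add: mult.commute mult.left_commute)
    qed
    ultimately show ?thesis by blast
  qed
  have ev: "\<forall>\<^sub>F \<beta> in at_top. 2 * l \<le> \<beta>"
    by (rule eventually_ge_at_top)
  show thesis
  proof (rule that [of "2 * k"])
    show "\<forall>\<^sub>F \<beta> in at_top. z \<in> resolvent_set (op_pencil A B \<beta>)"
      using ev by eventually_elim (use main in blast)
    show "\<forall>\<^sub>F \<beta> in at_top. \<forall>y. norm (resolvent (op_pencil A B \<beta>) z y - X y) \<le> 2 * k / \<beta> * norm y"
      using ev by eventually_elim (use main in blast)
  qed (use k in simp)
qed

end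

end

section \<open>Vanishing quasi-nilpotent part and the convergence theorem\<close>

context contour_around_zero
begin

text \<open>On the domain of \<open>B\<close> this is \<open>B P x = B x - B S B x = P B x = 0\<close>. For general \<open>x\<close>, approximate by \<open>x\<^sub>n\<close> in
  the domain: the points \<open>(P x\<^sub>n, 0)\<close> of the closed graph of \<open>B\<close> converge to \<open>(P x, 0)\<close>.\<close>

lemma riesz_onto_kernel:
  assumes closed: "closed_operator B" and dense: "densely_defined B"
    and quasinilpotent: "\<And>x. x \<in> domain B \<Longrightarrow> riesz (app B x) = 0"
  shows "riesz x \<in> domain B \<and> app B (riesz x) = 0"
proof -
  obtain S where S: "bounded_linear S" "\<And>y. S y \<in> domain B" "\<And>y. app B (S y) = y - riesz y"
    "\<And>x. x \<in> domain B \<Longrightarrow> S (app B x) = x - riesz x"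
    using reduced_resolvent by blast
  have on_domain: "riesz x \<in> domain B \<and> app B (riesz x) = 0" if x: "x \<in> domain B" for x
  proof -
    have eq: "riesz x = x - S (app B x)"
      by (simp add: S(4) [OF x])
    moreover have "x - S (app B x) \<in> domain B"
      by (intro linear_operator_simps(5) [OF linear] x S(2))
    moreover have "app B (x - S (app B x)) = 0"
      by (simp add: linear_operator_simps(6) [OF linear x S(2)] S(3) quasinilpotent [OF x])
    ultimately show ?thesis by simp
  qed
  have "x \<in> closure (domain B)"
    using dense by (simp add: densely_defined_def)
  then obtain f where f: "\<And>n. f n \<in> domain B" "f \<longlonglongrightarrow> x"
    unfolding closure_sequential by blast
  have "(\<lambda>n. (riesz (f n), 0 :: 'a)) \<longlonglongrightarrow> (riesz x, 0)"
    by (intro tendsto_Pair tendsto_const bounded_linear.tendsto [OF riesz_integral(2) f(2)])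
  moreover have "(riesz (f n), 0) \<in> {(x, app B x) | x. x \<in> domain B}" for n
    using on_domain [OF f(1)[of n]] by force
  ultimately have "(riesz x, 0) \<in> {(x, app B x) | x. x \<in> domain B}"
    using closed unfolding closed_operator_def by (metis (no_types, lifting) closed_sequentially)
  then show ?thesis by auto
qed

lemma pencil_decouples:
  assumes A: "linear_operator A" and rb: "relatively_bounded A B"
    and closed: "closed_operator B" and dense: "densely_defined B"
    and quasinilpotent: "\<And>x. x \<in> domain B \<Longrightarrow> riesz (app B x) = 0"
  obtains S where "decoupled_pencil A B riesz S"
proof -
  obtain S0 where S0: "bounded_linear S0" "\<And>y. S0 y \<in> domain B"
    "\<And>y. app B (S0 y) = y - riesz y" "\<And>x. x \<in> domain B \<Longrightarrow> S0 (app B x) = x - riesz x"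
    using reduced_resolvent by blast
  interpret S0: bounded_linear S0 by (rule S0(1))
  note P_simps = bounded_clinear_simps [OF bounded_clinear_riesz]
  have kernel: "riesz x \<in> domain B" "app B (riesz x) = 0" for x
    using riesz_onto_kernel [OF closed dense quasinilpotent] by auto
  have idem: "riesz (riesz x) = riesz x" for x
    using S0(4) [OF kernel(1)] by (simp add: kernel(2) S0.zero)
  \<comment> \<open>Compressing \<open>S0\<close> to the complement of the range of \<open>P\<close> enforces \<open>P S = 0\<close> and \<open>S P = 0\<close>.\<close>
  define S where "S y = S0 (y - riesz y) - riesz (S0 (y - riesz y))" for y
  have "decoupled_pencil A B riesz S"
  proof (rule decoupled_pencil.intro)
    show "bounded_linear S"
      unfolding S_def [abs_def]
      by (intro bounded_linear_sub bounded_linear_compose [OF S0(1)] bounded_linear_compose [OF P_simps(1)]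
          bounded_linear_ident P_simps(1))
    show "S x \<in> domain B" for x
      unfolding S_def by (intro linear_operator_simps(5) [OF linear] S0 kernel)
    show "app B (S x) = x - riesz x" for x
      by (simp add: S_def linear_operator_simps(6) [OF linear S0(2) kernel(1)] S0(3) kernel(2) P_simps idem)
    show "riesz (S x) = 0" "S (riesz x) = 0" for x
      by (simp_all add: S_def P_simps idem S0.zero)
    show "S (app B x) = x - riesz x" if "x \<in> domain B" for x
      by (simp add: S_def quasinilpotent [OF that] S0(4) [OF that] P_simps idem)
  qed (use A rb linear kernel bounded_clinear_riesz idem in auto)
  then show thesis by (rule that)
qed

end

text \<open>The pointwise estimate also bounds the quotients defining \<open>onorm\<close>, so that their supremum is not a
  default value and is nonnegative.\<close>

lemma tendsto_onorm_0:
  fixes f :: "real \<Rightarrow> 'a::real_normed_vector \<Rightarrow> 'b::real_normed_vector"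
  assumes "\<forall>\<^sub>F \<beta> in at_top. \<forall>y. norm (f \<beta> y) \<le> C / \<beta> * norm y" "C \<ge> 0"
  shows "\<forall>\<^sub>F \<beta> in at_top. onorm (f \<beta>) \<le> C / \<beta>" and "((\<lambda>\<beta>. onorm (f \<beta>)) \<longlongrightarrow> 0) at_top"
proof -
  have *: "\<forall>\<^sub>F \<beta> in at_top. 0 \<le> onorm (f \<beta>) \<and> onorm (f \<beta>) \<le> C / \<beta>"
    using assms(1) eventually_gt_at_top [of 0]
  proof eventually_elim
    case (elim \<beta>)
    have quotient: "norm (f \<beta> y) / norm y \<le> C / \<beta>" for y
      using elim assms(2) by (cases "y = 0") (auto simp: divide_le_eq)
    have "norm (f \<beta> 0) / norm (0::'a) \<le> onorm (f \<beta>)"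
      unfolding onorm_def by (rule cSUP_upper [OF UNIV_I bdd_aboveI2 [OF quotient]])
    then show ?case
      using elim assms(2) by (auto intro: onorm_bound)
  qed
  then show "\<forall>\<^sub>F \<beta> in at_top. onorm (f \<beta>) \<le> C / \<beta>"
    by eventually_elim simp
  have "((\<lambda>\<beta>. C / \<beta>) \<longlongrightarrow> 0) at_top"
    by (intro tendsto_divide_0 [OF tendsto_const] filterlim_at_top_imp_at_infinity filterlim_ident)
  then show "((\<lambda>\<beta>. onorm (f \<beta>)) \<longlongrightarrow> 0) at_top"
    by (rule tendsto_sandwich [OF eventually_mono [OF *] eventually_mono [OF *] tendsto_const, rotated 2]) simp_all
qed

theorem theorem3p3:
  fixes A B :: "'a::chilbert_space unbounded_operator"
    and \<gamma> :: "real \<Rightarrow> complex"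
    and P PAP :: "'a \<Rightarrow> 'a"
  assumes "linear_operator B" and "closed_operator B" and "densely_defined B"
    and "linear_operator A" and "relatively_bounded A B"
    and "0 isolated_in spectrum B"
    and "encircling_contour B 0 \<gamma>"
    and "P = riesz_projection B \<gamma>"
    and "quasinilpotent_part_vanishes B P"
    and "PAP = (\<lambda>x. P (app A (P x)))"
  shows "range P \<subseteq> domain A \<and> bounded_clinear (\<lambda>x. app A (P x)) \<and>
    (\<forall>z. cmod z > onorm (\<lambda>x. app A (P x)) \<and> cmod z > onorm PAP \<longrightarrow>
       (\<forall>\<^sub>F \<beta> in at_top. z \<notin> spectrum (op_pencil A B \<beta>)) \<and>
       z \<notin> spectrum \<lparr>domain = UNIV, app = PAP\<rparr> \<and>
       (\<exists>C\<ge>0. \<forall>\<^sub>F \<beta> in at_top.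
          onorm (\<lambda>x. resolvent (op_pencil A B \<beta>) z x
                      - P (resolvent \<lparr>domain = UNIV, app = PAP\<rparr> z (P x))) \<le> C / \<beta>) \<and>
       gen_norm_resolvent_conv (op_pencil A B) P \<lparr>domain = range P, app = PAP\<rparr> z)"
proof -
  have "0 \<in> spectrum B"
    using assms(6) by (simp add: isolated_in_def)
  interpret \<gamma>: contour_around_zero B \<gamma>
  proof
    show "0 \<notin> path_image \<gamma>"
      using assms(7) \<open>0 \<in> spectrum B\<close> by (auto simp: encircling_contour_def spectrum_def)
  qed (use assms(1,7) in \<open>auto simp: encircling_contour_def\<close>)
  have P: "P = \<gamma>.riesz"
    by (simp add: assms(8) \<gamma>.riesz_def)
  have "\<gamma>.riesz (app B x) = 0" if "x \<in> domain B" for x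
    using assms(9) that by (simp add: P quasinilpotent_part_vanishes_def)
  then obtain S where "decoupled_pencil A B P S"
    using \<gamma>.pencil_decouples [OF assms(4,5,2,3)] P by metis
  then interpret D: decoupled_pencil A B P S .
  have range: "range P \<subseteq> domain A"
    using D.P_dom D.dom_subset by blast
  have main: "(\<forall>\<^sub>F \<beta> in at_top. z \<notin> spectrum (op_pencil A B \<beta>)) \<and>
       z \<notin> spectrum \<lparr>domain = UNIV, app = PAP\<rparr> \<and>
       (\<exists>C\<ge>0. \<forall>\<^sub>F \<beta> in at_top.
          onorm (\<lambda>x. resolvent (op_pencil A B \<beta>) z x
                      - P (resolvent \<lparr>domain = UNIV, app = PAP\<rparr> z (P x))) \<le> C / \<beta>) \<and>
       gen_norm_resolvent_conv (op_pencil A B) P \<lparr>domain = range P, app = PAP\<rparr> z"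
    if "onorm PAP < cmod z" for z
  proof -
    have z: "onorm (\<lambda>x. P (app A (P x))) < cmod z"
      using that by (simp add: assms(10))
    have X: "P (resolvent \<lparr>domain = UNIV, app = PAP\<rparr> z (P x)) = D.X z x"
      "P (resolvent \<lparr>domain = range P, app = PAP\<rparr> z (P x)) = D.X z x" for x
      using z D.P_X [OF z, of x] D.resolvent_range_eq [OF z, of x]
      by (simp_all add: D.X_def assms(10))
    obtain C where C: "C \<ge> 0" "\<forall>\<^sub>F \<beta> in at_top. z \<in> resolvent_set (op_pencil A B \<beta>)"
      "\<forall>\<^sub>F \<beta> in at_top. \<forall>y. norm (resolvent (op_pencil A B \<beta>) z y - D.X z y) \<le> C / \<beta> * norm y"
      using D.pencil_resolvent [OF z] by blast
    show ?thesis
    proof (intro conjI exI [of _ C])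
      show "\<forall>\<^sub>F \<beta> in at_top. z \<notin> spectrum (op_pencil A B \<beta>)"
        using C(2) by (simp add: spectrum_def)
      show "z \<notin> spectrum \<lparr>domain = UNIV, app = PAP\<rparr>"
        using D.z_in [OF z] by (simp add: spectrum_def assms(10))
      show "\<forall>\<^sub>F \<beta> in at_top. onorm (\<lambda>x. resolvent (op_pencil A B \<beta>) z x
          - P (resolvent \<lparr>domain = UNIV, app = PAP\<rparr> z (P x))) \<le> C / \<beta>"
        unfolding X by (rule tendsto_onorm_0(1) [OF C(3,1)])
      show "gen_norm_resolvent_conv (op_pencil A B) P \<lparr>domain = range P, app = PAP\<rparr> z"
        unfolding gen_norm_resolvent_conv_def X
        using D.z_in_range [OF z] C(2) tendsto_onorm_0(2) [OF C(3,1)] by (simp add: assms(10))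
    qed (rule C(1))
  qed
  show ?thesis
    by (intro conjI [OF range] conjI [OF D.bounded_clinear_AP] allI impI main) simp
qed

end
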